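(* Let $K$ be an imaginary quadratic field and let $D$ be such that $\mathcal{S}_D$ is nonempty. If $\mathcal{S}_D$ is finitely connected, then every point of $\widehat{K}=K\cup\{\infty\}$ lies on some circle of $\mathcal{S}_D$. In particular, the class group of $K$ is generated by the ideal classes of prime ideals whose norm divides $D\Delta$, and every ideal class in the principal genus (i.e. every square of an ideal class) contains an integral ideal of norm $D$.
   Context: $K$ is an imaginary quadratic field with ring of integers $\mathcal{O}$ and discriminant $\Delta<0$; $\sqrt{\Delta}=i\sqrt{|\Delta|}$. An oriented circle $C$ is determined by $\zeta\in\mathbb{C}$, $r,\hat r\in\mathbb{R}$ with $|\zeta|^2-r\hat r=1$; as a point set $C=\{\alpha/\beta\in\widehat{\mathbb{C}}: r|\alpha|^2-2\Re(\overline{\alpha}\beta\zeta)+\hat r|\beta|^2=0\}$; $r$ is its curvature, $\zeta$ its curvature-center, $\hat r$ its cocurvature, and $\mathbf{v}_C=[\zeta\;\overline{\zeta}\;\hat r\;r]$ (orientation: for $r\ne0$ the circle has center $\zeta/r$, radius $1/|r|$). For $D\in\mathbb{R}$, $\mathcal{S}_D$ is the set of oriented circles $C$ with $i\sqrt{D}\,\mathbf{v}_C\in\mathcal{O}^2\times\sqrt{\Delta}\mathbb{Z}^2$. $\mathcal{S}_D$ is finitely connected if there is $n\in\mathbb{N}$ such that every $C\in\mathcal{S}_D$ with nonzero curvature $r$ admits a chain $C=C_0,C_1,\dots,C_n$ of (not necessarily distinct) circles of $\mathcal{S}_D$ with $C_{k-1}\cap C_k\neq\emptyset$ for all $k$ and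 with $C_n$ of curvature of absolute value at most $|r|/2$.
   Formalization: D is additionally required to be positive; for D<0 the set S_D is a finite set of lines through 0 that cannot cover K (e.g. K=Q(i), D=-1 misses 1+i), and for D=0 no ideal class contains an ideal of norm 0. *)

theory Defs
  imports
    "HOL-Algebra.Algebra"
    "HOL-Algebra.Ideal_Product"
    "HOL-Algebra.Algebraic_Closure_Type"
    "HOL-Analysis.Analysis"
begin

section \<open>Imaginary quadratic fields inside the complex numbers\<close>

abbreviation complex_ring :: "complex ring" where
  "complex_ring \<equiv> ring_of_type_algebra"

definition imaginary_quadratic_field :: "complex set \<Rightarrow> bool" where
  "imaginary_quadratic_field K \<longleftrightarrow>
     subfield K complex_ring \<and> ring.dimension complex_ring 2 \<rat> K \<and> \<not> K \<subseteq> \<real>"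

definition integers_of :: "complex set \<Rightarrow> complex set" where
  "integers_of K = {z \<in> K. algebraic_int z}"

definition integer_ring :: "complex set \<Rightarrow> complex ring" where
  "integer_ring K = complex_ring\<lparr>carrier := integers_of K\<rparr>"

text \<open>The squared determinant of the two embeddings (the inclusion and complex conjugation)
  evaluated on any integral basis \<open>w1, w2\<close>.\<close>

definition discriminant :: "complex set \<Rightarrow> int" where
  "discriminant K = (THE d. \<exists>w1 w2.
     (\<forall>a b :: int. of_int a * w1 + of_int b * w2 = 0 \<longrightarrow> a = 0 \<and> b = 0) \<and>
     integers_of K = {of_int a * w1 + of_int b * w2 | a b :: int. True} \<and>
     of_int d = (w1 * cnj w2 - w2 * cnj w1)\<^sup>2)"

definition sqrt_disc :: "complex set \<Rightarrow> complex" where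
  "sqrt_disc K = \<i> * complex_of_real (sqrt \<bar>real_of_int (discriminant K)\<bar>)"


section \<open>The ideal class group\<close>

definition fractional_ideal :: "complex set \<Rightarrow> complex set \<Rightarrow> bool" where
  "fractional_ideal K I \<longleftrightarrow>
     I \<subseteq> K \<and> 0 \<in> I \<and> I \<noteq> {0} \<and>
     (\<forall>x\<in>I. \<forall>y\<in>I. x + y \<in> I) \<and>
     (\<forall>a\<in>integers_of K. \<forall>x\<in>I. a * x \<in> I) \<and>
     (\<exists>c\<in>integers_of K - {0}. \<forall>x\<in>I. c * x \<in> integers_of K)"

text \<open>\<open>ideal_prod complex_ring I J\<close> consists of the finite nonempty sums of products
  \<open>x * y\<close> with \<open>x\<close> in \<open>I\<close> and \<open>y\<close> in \<open>J\<close>, so it is the product of fractional ideals as well.\<close>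

definition fractional_ideal_group :: "complex set \<Rightarrow> complex set monoid" where
  "fractional_ideal_group K =
     \<lparr>carrier = {I. fractional_ideal K I}, monoid.mult = ideal_prod complex_ring, one = integers_of K\<rparr>"

definition principal_fractional_ideals :: "complex set \<Rightarrow> complex set set" where
  "principal_fractional_ideals K = {(\<lambda>a. x * a) ` integers_of K | x. x \<in> K - {0}}"

definition class_group :: "complex set \<Rightarrow> complex set set monoid" where
  "class_group K = fractional_ideal_group K Mod principal_fractional_ideals K"

text \<open>An ideal class is a coset, hence literally the set of fractional ideals in it.\<close>

definition ideal_class :: "complex set \<Rightarrow> complex set \<Rightarrow> complex set set" where
  "ideal_class K I = principal_fractional_ideals K #>\<^bsub>fractional_ideal_group K\<^esub> I"

definition principal_genus :: "complex set \<Rightarrow> complex set set set" where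
  "principal_genus K = {c \<otimes>\<^bsub>class_group K\<^esub> c | c. c \<in> carrier (class_group K)}"

definition ideal_norm :: "complex set \<Rightarrow> complex set \<Rightarrow> nat" where
  "ideal_norm K I = card (carrier (integer_ring K Quot I))"


section \<open>Oriented circles\<close>

text \<open>The extended complex plane is \<open>complex option\<close>, with \<open>None\<close> as the point at infinity.\<close>

definition ext_quotient :: "complex \<Rightarrow> complex \<Rightarrow> complex option" where
  "ext_quotient a b = (if b = 0 then None else Some (a / b))"

definition extended_field :: "complex set \<Rightarrow> complex option set" where
  "extended_field K = insert None (Some ` K)"

record circle_data =
  curv_center :: complex
  cocurvature :: real
  curvature :: real

definition oriented_circle :: "circle_data \<Rightarrow> bool" where
  "oriented_circle C \<longleftrightarrow> (cmod (curv_center C))\<^sup>2 - curvature C * cocurvature C = 1"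

definition circle_points :: "circle_data \<Rightarrow> complex option set" where
  "circle_points C = {ext_quotient a b | a b. (a, b) \<noteq> (0, 0) \<and>
     curvature C * (cmod a)\<^sup>2 - 2 * Re (cnj a * b * curv_center C)
       + cocurvature C * (cmod b)\<^sup>2 = 0}"

text \<open>\<open>csqrt\<close> is used because the real \<open>sqrt\<close> satisfies \<open>sqrt (- x) = - sqrt x\<close>.\<close>

definition circle_family :: "complex set \<Rightarrow> real \<Rightarrow> circle_data set" where
  "circle_family K D = {C. oriented_circle C \<and>
     (let s = \<i> * csqrt (complex_of_real D) in
       s * curv_center C \<in> integers_of K \<and>
       s * cnj (curv_center C) \<in> integers_of K \<and>
       (\<exists>m :: int. s * complex_of_real (cocurvature C) = sqrt_disc K * of_int m) \<and>
       (\<exists>m :: int. s * complex_of_real (curvature C) = sqrt_disc K * of_int m))}"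

definition finitely_connected :: "circle_data set \<Rightarrow> bool" where
  "finitely_connected S \<longleftrightarrow> (\<exists>n :: nat. \<forall>C\<in>S. curvature C \<noteq> 0 \<longrightarrow>
     (\<exists>chain :: nat \<Rightarrow> circle_data.
        chain 0 = C \<and> (\<forall>k\<le>n. chain k \<in> S) \<and>
        (\<forall>k\<in>{1..n}. circle_points (chain (k - 1)) \<inter> circle_points (chain k) \<noteq> {}) \<and>
        \<bar>curvature (chain n)\<bar> \<le> \<bar>curvature C\<bar> / 2))"

end

theory Submission
  imports Defs
begin

text \<open>The value of the Hermitian form of a circle at \<open>(\<alpha>, \<beta>)\<close> lies in a discrete set. If it never
  vanishes, take a circle where it is minimal in absolute value and move that circle by parabolic
  elements fixing \<open>p = \<alpha> / \<beta>\<close>: the value is kept while the circle shrinks towards \<open>p\<close>. After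
  boundedly many steps of comparable radius the chain reaches a circle of at most half the
  curvature, still close to \<open>p\<close>, where the value has roughly halved: a contradiction.

  A circle through \<open>\<alpha> / \<beta>\<close>, where \<open>I = (\<alpha>, \<beta>)\<close>, gives an integral ideal of norm \<open>D\<close> equivalent to
  \<open>I\<^sup>2\<close>. Comparing this ideal with an equivalent of the unit ideal of the same norm \<open>D\<close> shows that
  \<open>I\<close> is equivalent to a divisor of norm dividing \<open>D\<close> times an ideal whose class has order at most
  two, and such a class contains an ambiguous ideal of norm dividing the discriminant.\<close>

text \<open>Let r be the curvature of a circle (taken in absolute value) and mu its form value at p.
  The product r * mu does not change under rescaling of the plane. Points of the circle lie within
  about sqrt(mu / r) of p, and a circle of curvature r with a point at distance h from p has value
  at most r * h^2 + 2 * h. A chain of length n drifts by O(n / r) before the curvature halves, which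
  is negligible once sqrt(r * mu) is large compared with n. The minimal circle need not satisfy
  this; the parabolic move raises r at fixed mu. It can do so because mu is nonzero: the curvature
  of the moved circle is quadratic in the parameter, with leading coefficient a positive multiple of
  the value at p.

  The arithmetic rests on the identity I * cnj I = N(I) \<O>, read off from a lattice basis. It
  yields inverses, multiplicativity of the norm and the equivalence of containment with
  divisibility. Ambiguous ideals arise as in Hilbert 90: if I * I is principal, then cnj I = y * I
  with y of absolute value 1, and y is a quotient z / cnj z.\<close>

section \<open>The quadratic field and its ring of integers\<close>

lemma complex_ring_simps [simp]:
  "carrier complex_ring = UNIV" "x \<otimes>\<^bsub>complex_ring\<^esub> y = x * y" "\<one>\<^bsub>complex_ring\<^esub> = 1"
  "\<zero>\<^bsub>complex_ring\<^esub> = 0" "x \<oplus>\<^bsub>complex_ring\<^esub> y = x + y"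
  by (simp_all add: ring_of_type_algebra_def)

lemma ring_complex_ring: "ring complex_ring"
  by (rule ring_from_type_algebra)

lemma a_inv_complex_ring [simp]: "\<ominus>\<^bsub>complex_ring\<^esub> x = - (x :: complex)"
proof -
  interpret ring complex_ring by (rule ring_complex_ring)
  have "\<ominus>\<^bsub>complex_ring\<^esub> x \<oplus>\<^bsub>complex_ring\<^esub> x = 0"
    using l_neg[of x] by simp
  thus ?thesis by (simp add: eq_neg_iff_add_eq_0)
qed

lemma line_extension_complex_ring:
  "ring.line_extension complex_ring F v E = {k * v + e | k e. k \<in> F \<and> e \<in> E}"
  by (auto simp: ring.line_extension_def[OF ring_complex_ring] set_add_def set_mult_def r_coset_def)

lemma dimension_Suc_complex_ring:
  assumes "ring.dimension complex_ring (Suc n) F E"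
  obtains v E' where "ring.dimension complex_ring n F E'" "E = {k * v + e | k e. k \<in> F \<and> e \<in> E'}"
  using assms
  by (cases rule: ring.dimension.cases[OF ring_complex_ring])
     (auto simp: line_extension_complex_ring)

lemma dimension_0_complex_ring:
  assumes "ring.dimension complex_ring 0 F E"
  shows "E = {0}"
  using assms
  by (cases rule: ring.dimension.cases[OF ring_complex_ring]) auto

lemma Im_Rats [simp]: "x \<in> \<rat> \<Longrightarrow> Im x = 0"
  by (auto elim!: Rats_cases simp: of_rat_def)

locale imaginary_quadratic =
  fixes K :: "complex set"
  assumes field_K: "imaginary_quadratic_field K"
begin

lemma subfield_K: "subfield K complex_ring"
  using field_K by (simp add: imaginary_quadratic_field_def)

lemma subcring_K: "subcring K complex_ring"
  using subfield_K by (rule subfieldE)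

lemma K_add [intro]: "x \<in> K \<Longrightarrow> y \<in> K \<Longrightarrow> x + y \<in> K"
  using subcringE(7)[OF subcring_K] by simp

lemma K_mult [intro]: "x \<in> K \<Longrightarrow> y \<in> K \<Longrightarrow> x * y \<in> K"
  using subcringE(6)[OF subcring_K] by simp

lemma K_uminus [intro]: "x \<in> K \<Longrightarrow> - x \<in> K"
  using subcringE(5)[OF subcring_K] by simp

lemma K_diff [intro]: "x \<in> K \<Longrightarrow> y \<in> K \<Longrightarrow> x - y \<in> K"
  using K_add[of x "- y"] by auto

lemma K_0 [intro]: "0 \<in> K" and K_1 [intro]: "1 \<in> K"
  using subcringE(2,3)[OF subcring_K] by simp_all

lemma K_inverse [intro]: "x \<in> K \<Longrightarrow> inverse x \<in> K"
proof (cases "x = 0")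
  case False
  assume "x \<in> K"
  interpret K: field "complex_ring\<lparr>carrier := K\<rparr>"
    using ring.subfield_iff(2)[OF ring_complex_ring subfield_K] .
  have "x \<in> Units (complex_ring\<lparr>carrier := K\<rparr>)"
    using K.field_Units \<open>x \<in> K\<close> False by simp
  then obtain y where "y \<in> K" "x * y = 1"
    by (auto simp: Units_def)
  thus ?thesis
    using inverse_unique by metis
qed auto

lemma K_divide [intro]: "x \<in> K \<Longrightarrow> y \<in> K \<Longrightarrow> x / y \<in> K"
  by (simp add: divide_inverse K_mult K_inverse)

lemma K_of_nat: "of_nat n \<in> K"
  by (induction n) auto

lemma K_of_int: "of_int n \<in> K"
  by (cases n) (auto intro: K_of_nat simp del: of_nat_Suc)

lemma K_Rats: "\<rat> \<subseteq> K"
proof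
  fix x :: complex assume "x \<in> \<rat>"
  then obtain a b where "x = of_int a / of_int b"
    by (metis Rats_cases')
  thus "x \<in> K" using K_of_int by auto
qed

text \<open>Two-dimensionality gives some spanning pair u, v; expressing 1 and a nonreal z through
  it and solving by Cramer's rule replaces the pair by 1, z.\<close>

lemma K_basis:
  obtains z where "z \<in> K" "Im z \<noteq> 0" "K = {a + b * z | a b. a \<in> \<rat> \<and> b \<in> \<rat>}"
proof -
  obtain z where z: "z \<in> K" "Im z \<noteq> 0"
    using field_K complex_is_Real_iff unfolding imaginary_quadratic_field_def by blast
  have "ring.dimension complex_ring (Suc (Suc 0)) \<rat> K"
    using field_K by (simp add: imaginary_quadratic_field_def numeral_2_eq_2)
  then obtain u E where E: "ring.dimension complex_ring (Suc 0) \<rat> E"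
    and K: "K = {k * u + e | k e. k \<in> \<rat> \<and> e \<in> E}"
    by (rule dimension_Suc_complex_ring)
  from E obtain v E' where "ring.dimension complex_ring 0 \<rat> E'"
    and "E = {k * v + e | k e. k \<in> \<rat> \<and> e \<in> E'}"
    by (rule dimension_Suc_complex_ring)
  hence E: "E = {k * v | k. k \<in> \<rat>}"
    using dimension_0_complex_ring[of \<rat> E'] by auto
  have K: "K = {k * u + l * v | k l. k \<in> \<rat> \<and> l \<in> \<rat>}"
    unfolding K E by auto
  obtain k l where 1: "k \<in> \<rat>" "l \<in> \<rat>" "1 = k * u + l * v"
    using K_1 K by blast
  obtain m n where 2: "m \<in> \<rat>" "n \<in> \<rat>" "z = m * u + n * v"
    using z K by blast
  \<comment> \<open>The determinant of the coordinates of 1 and z; if it vanished, z would be forced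
    to be real.\<close>
  define d where "d = k * n - l * m"
  have "n - l * z = n * (1 - l * v) - l * m * u"
    unfolding 2(3) by (simp add: algebra_simps)
  also have "1 - l * v = k * u" using 1(3) by (simp add: algebra_simps)
  finally have u: "d * u = n - l * z" by (simp add: d_def algebra_simps)
  have "k * z - m = k * n * v - m * (1 - k * u)"
    unfolding 2(3) by (simp add: algebra_simps)
  also have "1 - k * u = l * v" using 1(3) by (simp add: algebra_simps)
  finally have v: "d * v = k * z - m" by (simp add: d_def algebra_simps)
  have "d \<noteq> 0"
  proof
    assume "d = 0"
    hence "n = l * z" "k * z = m" using u v by auto
    moreover have "Im (l * z) = Re l * Im z" "Im (k * z) = Re k * Im z"
      using 1 by auto
    ultimately have "Re l = 0" "Re k = 0"
      using 2 z Im_Rats[of n] Im_Rats[of m] by auto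
    hence "l = 0" "k = 0" using 1 by (auto simp: complex_eq_iff)
    thus False using 1 by simp
  qed
  have d: "d \<in> \<rat>" using 1 2 by (simp add: d_def)
  have "K \<subseteq> {a + b * z | a b. a \<in> \<rat> \<and> b \<in> \<rat>}"
  proof
    fix x assume "x \<in> K"
    then obtain s t where st: "s \<in> \<rat>" "t \<in> \<rat>" "x = s * u + t * v"
      using K by blast
    have "d * x = s * (d * u) + t * (d * v)"
      unfolding st(3) by (simp add: algebra_simps)
    also have "\<dots> = (s * n - t * m) + (t * k - s * l) * z"
      unfolding u v by (simp add: algebra_simps)
    finally have "x = (s * n - t * m) / d + (t * k - s * l) / d * z"
      using \<open>d \<noteq> 0\<close> by (simp add: field_simps)
    moreover have "(s * n - t * m) / d \<in> \<rat>" "(t * k - s * l) / d \<in> \<rat>"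
      using st 1 2 d by auto
    ultimately show "x \<in> {a + b * z | a b. a \<in> \<rat> \<and> b \<in> \<rat>}"
      by blast
  qed
  moreover have "{a + b * z | a b. a \<in> \<rat> \<and> b \<in> \<rat>} \<subseteq> K"
    using z K_Rats by auto
  ultimately show ?thesis using z that by blast
qed

lemma K_real_Rats:
  assumes "x \<in> K" "Im x = 0"
  shows "x \<in> \<rat>"
proof -
  obtain z where z: "z \<in> K" "Im z \<noteq> 0" "K = {a + b * z | a b. a \<in> \<rat> \<and> b \<in> \<rat>}"
    by (rule K_basis)
  then obtain a b where ab: "a \<in> \<rat>" "b \<in> \<rat>" "x = a + b * z"
    using assms by blast
  hence "Re b = 0" using assms z by simp
  hence "b = 0" using ab by (auto simp: complex_eq_iff)
  thus ?thesis using ab by simp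
qed

text \<open>Both z and \<open>cnj z\<close> are roots of X^2 = a + b X with rational a, b, and they
  differ, so their sum is b.\<close>

lemma K_cnj_aux:
  assumes "z \<in> K" "Im z \<noteq> 0" "K = {a + b * z | a b. a \<in> \<rat> \<and> b \<in> \<rat>}"
  shows "z + cnj z \<in> \<rat>"
proof -
  have "z * z \<in> K" using assms(1) by auto
  then obtain a b where ab: "a \<in> \<rat>" "b \<in> \<rat>" "z * z = a + b * z"
    using assms(3) by blast
  have [simp]: "cnj a = a" "cnj b = b" using ab by (auto simp: complex_eq_iff)
  have "cnj z * cnj z = a + b * cnj z"
    using arg_cong[OF ab(3), of cnj] by simp
  hence "(z - cnj z) * (z + cnj z - b) = 0"
    using ab(3) by (simp add: algebra_simps)
  moreover have "z - cnj z \<noteq> 0" using assms(2) by (auto simp: complex_eq_iff)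
  ultimately show ?thesis using ab by simp
qed

lemma K_cnj [intro]:
  assumes "x \<in> K" shows "cnj x \<in> K"
proof -
  obtain z where z: "z \<in> K" "Im z \<noteq> 0" "K = {a + b * z | a b. a \<in> \<rat> \<and> b \<in> \<rat>}"
    by (rule K_basis)
  then obtain a b where ab: "a \<in> \<rat>" "b \<in> \<rat>" "x = a + b * z"
    using assms by blast
  have "cnj z = (z + cnj z) - z" by simp
  also have "\<dots> \<in> K" using K_cnj_aux[OF z] K_Rats z(1) by blast
  finally have "cnj z \<in> K" .
  moreover have "cnj x = a + b * cnj z" using ab by (simp add: complex_eq_iff)
  ultimately show ?thesis using ab K_Rats by auto
qed

lemma K_trace: "x \<in> K \<Longrightarrow> x + cnj x \<in> \<rat>"
  by (rule K_real_Rats) auto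

lemma K_norm: "x \<in> K \<Longrightarrow> x * cnj x \<in> \<rat>"
  by (rule K_real_Rats) auto

end

section \<open>Integrality in terms of trace and norm\<close>

lemma algebraic_int_quadraticI:
  assumes "x + cnj x \<in> \<int>" "x * cnj x \<in> \<int>"
  shows "algebraic_int x"
proof (rule algebraic_int.intros[of "[:x * cnj x, - (x + cnj x), 1:]"])
  show "\<forall>i. coeff [:x * cnj x, - (x + cnj x), 1:] i \<in> \<int>"
    using assms Ints_minus[OF assms(1)] by (auto simp: coeff_pCons split: nat.splits)
qed (auto simp: algebra_simps)

lemma map_poly_of_int_add:
  "map_poly of_int (p + q) = map_poly of_int p + (map_poly of_int q :: 'a :: comm_ring_1 poly)"
  by (intro poly_eqI) (simp add: coeff_map_poly)

lemma map_poly_of_int_mult: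
  "map_poly of_int (p * q) = map_poly of_int p * (map_poly of_int q :: 'a :: comm_ring_1 poly)"
  by (intro poly_eqI) (simp add: coeff_map_poly coeff_mult)

lemma map_poly_of_int_smult:
  "map_poly of_int (smult c p) = smult (of_int c) (map_poly of_int p :: 'a :: comm_ring_1 poly)"
  by (rule map_poly_smult) auto

text \<open>By Gauss's lemma the primitive integral quadratic polynomial vanishing at an
  algebraic integer is monic up to sign, because it divides a monic integral polynomial.\<close>

lemma algebraic_int_quadratic_lead_coeff:
  fixes x :: complex and p :: "int poly"
  assumes "algebraic_int x" "Im x \<noteq> 0"
    and "degree p = 2" "Polynomial.content p = 1" "poly (map_poly of_int p) x = 0"
  shows "\<bar>lead_coeff p\<bar> = 1"
proof -
  obtain f :: "int poly" where f: "poly (map_poly of_int f) x = 0" "lead_coeff f = 1"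
    using assms(1) by (auto simp: algebraic_int_altdef_ipoly)
  have "p \<noteq> 0" using assms by auto
  obtain q r where qr: "pseudo_divmod f p = (q, r)" by force
  define k where "k = Suc (degree f) - degree p"
  define d where "d = lead_coeff p"
  have eq: "smult (d ^ k) f = p * q + r" and r: "r = 0 \<or> degree r < degree p"
    using pseudo_divmod[OF \<open>p \<noteq> 0\<close> qr] by (simp_all add: k_def d_def)
  have root: "poly (map_poly of_int r) x = 0"
  proof -
    have "map_poly of_int (smult (d ^ k) f) = (map_poly of_int (p * q + r) :: complex poly)"
      by (simp only: eq)
    from arg_cong[OF this, of "\<lambda>p. poly p x"] show ?thesis
      using f assms by (simp add: map_poly_of_int_add map_poly_of_int_mult map_poly_of_int_smult)
  qed
  \<comment> \<open>The remainder has degree at most one and rational coefficients, so it cannot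
    have a nonreal root unless it is zero.\<close>
  have "r = 0"
  proof -
    have "degree r \<le> 1" using r assms(3) by auto
    hence "coeff r n = coeff [:coeff r 0, coeff r 1:] n" for n
      by (cases n) (auto simp: coeff_pCons coeff_eq_0 split: nat.splits)
    then obtain a b where ab: "r = [:a, b:]"
      by (metis poly_eqI)
    hence 0: "of_int a + of_int b * x = 0"
      using root by (simp add: map_poly_pCons mult.commute)
    moreover have "Im (of_int a + of_int b * x) = of_int b * Im x" by simp
    ultimately have "of_int b * Im x = 0" by (metis zero_complex.sel(2))
    thus ?thesis using 0 ab assms(2) by simp
  qed
  hence eq: "smult (d ^ k) f = p * q" using eq by simp
  have "is_unit (Polynomial.content f)"
    using f(2) content_dvd_coeff[of f "degree f"] by simp
  hence cf: "Polynomial.content f = 1"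
    using is_unit_content_iff by blast
  \<comment> \<open>Both f and p have content 1, so all of d^k sits in the content of q and divides
    its leading coefficient. Comparing leading coefficients then makes d a unit.\<close>
  have "Polynomial.content q = \<bar>d\<bar> ^ k"
    using arg_cong[OF eq, of Polynomial.content] cf assms(4) by (simp add: content_mult power_abs)
  hence "\<bar>d\<bar> ^ k dvd lead_coeff q"
    by (metis content_dvd_coeff)
  hence "d ^ k dvd lead_coeff q"
    by (simp flip: power_abs)
  then obtain m where m: "lead_coeff q = d ^ k * m" ..
  have "d ^ k = d * lead_coeff q"
    using arg_cong[OF eq, of lead_coeff] f(2) \<open>p \<noteq> 0\<close> by (simp add: lead_coeff_mult d_def)
  hence "d ^ k * (d * m) = d ^ k * 1" unfolding m by simp
  moreover have "d ^ k \<noteq> 0" using \<open>p \<noteq> 0\<close> by (simp add: d_def)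
  ultimately have "d * m = 1" by (metis mult_left_cancel)
  hence "d dvd 1" by (metis dvd_triv_left)
  thus ?thesis by (simp add: d_def)
qed

context imaginary_quadratic
begin

abbreviation "\<O> \<equiv> integers_of K"

lemma O_in_K: "x \<in> \<O> \<Longrightarrow> x \<in> K"
  by (simp add: integers_of_def)

lemma O_real_Ints: "x \<in> \<O> \<Longrightarrow> Im x = 0 \<Longrightarrow> x \<in> \<int>"
  using K_real_Rats rational_algebraic_int_is_int by (auto simp: integers_of_def)

lemma K_trace_norm_rational:
  assumes "x \<in> K"
  obtains a b c d :: int where "b \<noteq> 0" "d \<noteq> 0"
    "x + cnj x = of_int a / of_int b" "x * cnj x = of_int c / of_int d"
proof -
  obtain a b where "b > 0" "x + cnj x = of_int a / of_int b"
    using K_trace[OF assms] by (metis Rats_cases')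
  moreover obtain c d where "d > 0" "x * cnj x = of_int c / of_int d"
    using K_norm[OF assms] by (metis Rats_cases')
  ultimately show ?thesis using that by (metis less_irrefl)
qed

text \<open>For nonreal x, the polynomial X^2 - (trace) X + (norm) with denominators cleared is
  \<open>P\<close>. Its primitive part has leading coefficient 1 or -1, so trace and norm are its
  remaining coefficients up to sign.\<close>

lemma O_trace_norm:
  assumes "x \<in> \<O>"
  shows "x + cnj x \<in> \<int> \<and> x * cnj x \<in> \<int>"
proof (cases "Im x = 0")
  case True
  hence "cnj x = x" by (simp add: complex_eq_iff)
  thus ?thesis using O_real_Ints[OF assms True] by auto
next
  case False
  obtain a b c d :: int where abcd: "b \<noteq> 0" "d \<noteq> 0"
    "x + cnj x = of_int a / of_int b" "x * cnj x = of_int c / of_int d"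
    using K_trace_norm_rational[OF O_in_K[OF assms]] by metis
  define P where "P = [:c * b, - (a * d), b * d:]"
  define k where "k = Polynomial.content P"
  have P: "P \<noteq> 0" "degree P = 2" using abcd by (auto simp: P_def)
  have cx: "cnj x = of_int a / of_int b - x" using abcd(3) by (simp add: algebra_simps)
  have "x * (of_int a / of_int b - x) = of_int c / of_int d"
    using abcd(4) unfolding cx .
  hence "poly (map_poly of_int P) x = 0"
    using abcd(1,2) by (simp add: P_def map_poly_pCons field_simps)
  define Q where "Q = primitive_part P"
  have PQ: "P = smult k Q" by (simp add: k_def Q_def)
  have k: "k \<noteq> 0" using P by (simp add: k_def)
  have "poly (map_poly of_int Q) x = 0"
    using \<open>poly (map_poly of_int P) x = 0\<close> k unfolding PQ by (simp add: map_poly_of_int_smult)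
  hence lead: "\<bar>lead_coeff Q\<bar> = 1"
    using algebraic_int_quadratic_lead_coeff[of x Q] assms False P
    by (simp add: Q_def integers_of_def)
  define l where "l = coeff Q 2"
  have l: "l = 1 \<or> l = - 1" using lead P by (auto simp: Q_def l_def)
  have "coeff P 0 = k * coeff Q 0" "coeff P 1 = k * coeff Q 1" "coeff P 2 = k * l"
    unfolding PQ by (simp_all add: l_def)
  hence co: "c * b = k * coeff Q 0" "- (a * d) = k * coeff Q 1" "b * d = k * l"
    by (simp_all add: P_def numeral_2_eq_2)
  have "of_int (b * d) * (x + cnj x) = of_int (a * d)" "of_int (b * d) * (x * cnj x) = of_int (c * b)"
    unfolding abcd(3,4) using abcd(1,2) by simp_all
  moreover have "a * d = k * (- coeff Q 1)" using co(2) by simp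
  ultimately have "of_int k * (of_int l * (x + cnj x)) = of_int k * of_int (- coeff Q 1)"
    "of_int k * (of_int l * (x * cnj x)) = of_int k * of_int (coeff Q 0)"
    unfolding co by (simp_all add: mult_ac)
  hence "of_int l * (x + cnj x) = of_int (- coeff Q 1)" "of_int l * (x * cnj x) = of_int (coeff Q 0)"
    using k by (simp_all only: mult_cancel_left of_int_eq_0_iff) auto
  hence "x + cnj x = of_int l * of_int (- coeff Q 1)" "x * cnj x = of_int l * of_int (coeff Q 0)"
    using l by (auto simp: minus_equation_iff[of "x * cnj x"] minus_equation_iff[of "x + cnj x"] simp del: minus_add_distrib)
  thus ?thesis by (metis Ints_mult Ints_of_int)
qed

text \<open>Reduces membership to two integrality conditions, from which closure of \<O> under the
  ring operations is derived below.\<close>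

lemma O_iff: "x \<in> \<O> \<longleftrightarrow> x \<in> K \<and> x + cnj x \<in> \<int> \<and> x * cnj x \<in> \<int>"
  using O_trace_norm[of x] algebraic_int_quadraticI[of x] by (auto simp: integers_of_def)

text \<open>The traces of \<open>x * cnj y\<close> and of \<open>x * y\<close> have an integral sum and an integral
  product.\<close>

lemma O_trace_cnj:
  assumes "x \<in> \<O>" "y \<in> \<O>"
  shows "x * cnj y + cnj x * y \<in> \<int>"
proof -
  define s where "s = x * cnj y + cnj x * y"
  define s' where "s' = x * y + cnj x * cnj y"
  have x: "x + cnj x \<in> \<int>" "x * cnj x \<in> \<int>" and y: "y + cnj y \<in> \<int>" "y * cnj y \<in> \<int>"
    and K: "x \<in> K" "y \<in> K"
    using assms by (simp_all add: O_iff)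
  have "s + s' = (x + cnj x) * (y + cnj y)"
    by (simp add: s_def s'_def algebra_simps)
  hence 1: "s + s' \<in> \<int>" using x y by auto
  have "s * s' = ((x + cnj x)\<^sup>2 - 2 * (x * cnj x)) * (y * cnj y)
    + ((y + cnj y)\<^sup>2 - 2 * (y * cnj y)) * (x * cnj x)"
    by (simp add: s_def s'_def algebra_simps power2_eq_square)
  moreover have "2 \<in> (\<int> :: complex set)" by simp
  ultimately have 2: "s * s' \<in> \<int>" using x y by (metis Ints_mult Ints_add Ints_diff Ints_power)
  have "algebraic_int s"
  proof (rule algebraic_int.intros[of "[:s * s', - (s + s'), 1:]"])
    show "\<forall>i. coeff [:s * s', - (s + s'), 1:] i \<in> \<int>"
      using Ints_minus[OF 1] 2 by (auto simp: coeff_pCons split: nat.splits)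
  qed (auto simp: algebra_simps)
  moreover have "s \<in> \<rat>"
    unfolding s_def using K by (intro K_real_Rats) auto
  ultimately show ?thesis
    unfolding s_def by (rule rational_algebraic_int_is_int)
qed

lemma O_cnj [intro]: "x \<in> \<O> \<Longrightarrow> cnj x \<in> \<O>"
  by (auto simp: O_iff add.commute mult.commute)

lemma O_add [intro]:
  assumes "x \<in> \<O>" "y \<in> \<O>"
  shows "x + y \<in> \<O>"
proof -
  have "(x + y) + cnj (x + y) = (x + cnj x) + (y + cnj y)"
    "(x + y) * cnj (x + y) = x * cnj x + y * cnj y + (x * cnj y + cnj x * y)"
    by (simp_all add: algebra_simps)
  thus ?thesis
    unfolding O_iff using assms O_trace_cnj[OF assms] Ints_add K_add by (metis O_iff)
qed

lemma O_mult [intro]: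
  assumes "x \<in> \<O>" "y \<in> \<O>"
  shows "x * y \<in> \<O>"
proof -
  have "(x * y) * cnj (x * y) = (x * cnj x) * (y * cnj y)"
    by (simp add: algebra_simps)
  thus ?thesis
    unfolding O_iff using assms O_trace_cnj[OF assms(1) O_cnj[OF assms(2)]] Ints_mult K_mult
    by (metis O_iff complex_cnj_cnj complex_cnj_mult)
qed

lemma O_uminus [intro]: "x \<in> \<O> \<Longrightarrow> - x \<in> \<O>"
  using Ints_minus[of "x + cnj x"] by (auto simp: O_iff)

lemma O_diff [intro]: "x \<in> \<O> \<Longrightarrow> y \<in> \<O> \<Longrightarrow> x - y \<in> \<O>"
  using O_add[of x "- y"] by auto

lemma O_of_int [intro, simp]: "of_int n \<in> \<O>"
  by (auto simp: O_iff K_of_int)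

lemma O_0 [intro, simp]: "0 \<in> \<O>" and O_1 [intro, simp]: "1 \<in> \<O>"
  using O_of_int[of 0] O_of_int[of 1] by simp_all

lemma K_denom:
  assumes "x \<in> K" obtains c :: int where "c > 0" "of_int c * x \<in> \<O>"
proof -
  obtain a b c d :: int where abcd: "b \<noteq> 0" "d \<noteq> 0"
    "x + cnj x = of_int a / of_int b" "x * cnj x = of_int c / of_int d"
    using K_trace_norm_rational[OF assms] by metis
  define w where "w = of_int (b * d) * x"
  have "w + cnj w = of_int (b * d) * (x + cnj x)" by (simp add: w_def algebra_simps)
  also have "\<dots> = of_int (a * d)" unfolding abcd using abcd(1,2) by simp
  finally have 1: "w + cnj w \<in> \<int>" by simp
  have "w * cnj w = of_int ((b * d)\<^sup>2) * (x * cnj x)" by (simp add: w_def power2_eq_square)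
  also have "\<dots> = of_int (b\<^sup>2 * d * c)" unfolding abcd using abcd(1,2)
    by (simp add: power2_eq_square)
  finally have 2: "w * cnj w \<in> \<int>" by (metis Ints_of_int)
  have "w \<in> K" unfolding w_def using assms K_of_int by blast
  hence "w \<in> \<O>" using 1 2 by (simp add: O_iff)
  moreover from this have "of_int (- (b * d)) * x \<in> \<O>"
    using O_uminus[of w] by (simp add: w_def)
  moreover have "b * d > 0 \<or> - (b * d) > 0" using abcd by auto
  ultimately show ?thesis using that unfolding w_def by blast
qed

section \<open>Integral basis and discriminant\<close>

lemma O_nonreal_exists: "\<exists>x\<in>\<O>. Im x > 0"
proof -
  obtain z where z: "z \<in> K" "Im z \<noteq> 0" by (rule K_basis)
  obtain c :: int where c: "c > 0" "of_int c * z \<in> \<O>" by (rule K_denom[OF z(1)])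
  hence "Im (of_int c * z) > 0 \<or> Im (- (of_int c * z)) > 0"
    using z by (auto simp: zero_less_mult_iff mult_less_0_iff)
  thus ?thesis using c O_uminus[OF c(2)] by blast
qed

text \<open>With trace t and norm n the number is 4 n - t^2. Imaginary parts are therefore discrete
  and a least positive one exists.\<close>

lemma O_Im_square:
  assumes "x \<in> \<O>" obtains n :: nat where "4 * (Im x)\<^sup>2 = of_nat n"
proof -
  obtain t n where t: "x + cnj x = of_int t" and n: "x * cnj x = of_int n"
    using O_trace_norm[OF assms] by (auto elim!: Ints_cases)
  have "of_int t = 2 * Re x" using t by (simp add: complex_eq_iff)
  moreover have "of_int n = (Re x)\<^sup>2 + (Im x)\<^sup>2"
    using n by (simp add: complex_eq_iff power2_eq_square)
  ultimately have "4 * (Im x)\<^sup>2 = of_int (4 * n - t\<^sup>2)"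
    by (simp only: of_int_diff of_int_mult of_int_power of_int_numeral) (simp add: power2_eq_square)
  moreover from this have "4 * n - t\<^sup>2 \<ge> 0"
    by (metis of_int_0_le_iff zero_le_mult_iff zero_le_numeral zero_le_power2)
  ultimately show ?thesis using that by (metis of_int_of_nat_eq zero_le_imp_eq_int)
qed

text \<open>The choice is unique only up to adding integers. Taking a least positive imaginary part
  gives a second basis element without a case distinction on residues modulo 4.\<close>

definition \<theta> :: complex where
  "\<theta> = (SOME t. t \<in> \<O> \<and> Im t > 0 \<and> (\<forall>x\<in>\<O>. Im x > 0 \<longrightarrow> Im t \<le> Im x))"

lemma theta: "\<theta> \<in> \<O>" "Im \<theta> > 0" "\<And>x. x \<in> \<O> \<Longrightarrow> Im x > 0 \<Longrightarrow> Im \<theta> \<le> Im x"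
proof -
  define P where "P n \<longleftrightarrow> (\<exists>x\<in>\<O>. Im x > 0 \<and> 4 * (Im x)\<^sup>2 = of_nat n)" for n :: nat
  have "\<exists>n. P n" unfolding P_def using O_nonreal_exists O_Im_square by metis
  then obtain t where t: "t \<in> \<O>" "Im t > 0" "4 * (Im t)\<^sup>2 = of_nat (LEAST n. P n)"
    using LeastI_ex[of P] unfolding P_def by blast
  have "Im t \<le> Im x" if x: "x \<in> \<O>" "Im x > 0" for x
  proof -
    obtain n :: nat where n: "4 * (Im x)\<^sup>2 = of_nat n" using O_Im_square x by blast
    hence "(LEAST n. P n) \<le> n" by (intro Least_le) (use x in \<open>auto simp: P_def\<close>)
    hence "4 * (Im t)\<^sup>2 \<le> 4 * (Im x)\<^sup>2" unfolding n t by simp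
    hence "(Im t)\<^sup>2 \<le> (Im x)\<^sup>2" by simp
    thus ?thesis by (rule power2_le_imp_le) (use x in simp)
  qed
  hence "\<exists>t. t \<in> \<O> \<and> Im t > 0 \<and> (\<forall>x\<in>\<O>. Im x > 0 \<longrightarrow> Im t \<le> Im x)" using t by blast
  from someI_ex[OF this] show "\<theta> \<in> \<O>" "Im \<theta> > 0" "\<And>x. x \<in> \<O> \<Longrightarrow> Im x > 0 \<Longrightarrow> Im \<theta> \<le> Im x"
    by (simp_all add: \<theta>_def)
qed

text \<open>Subtracting a floor multiple of \<theta> leaves an imaginary part in [0,
  \<open>Im \<theta>\<close>), which minimality forces to be 0; real elements of \<O> are
  integers.\<close>

lemma O_basis: "\<O> = {of_int a + of_int b * \<theta> | a b. True}"
proof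
  show "{of_int a + of_int b * \<theta> | a b. True} \<subseteq> \<O>" using theta(1) by auto
  show "\<O> \<subseteq> {of_int a + of_int b * \<theta> | a b. True}"
  proof
    fix x assume x: "x \<in> \<O>"
    define b where "b = \<lfloor>Im x / Im \<theta>\<rfloor>"
    define y where "y = x - of_int b * \<theta>"
    have y: "y \<in> \<O>" unfolding y_def using x theta(1) by blast
    have "of_int b \<le> Im x / Im \<theta>" "Im x / Im \<theta> < of_int b + 1"
      unfolding b_def by linarith+
    hence "0 \<le> Im y" "Im y < Im \<theta>"
      using theta(2) by (simp_all add: y_def field_simps)
    hence "Im y = 0" using theta(3)[OF y] by force
    then obtain a where "y = of_int a" using O_real_Ints[OF y] by (auto elim: Ints_cases)
    thus "x \<in> {of_int a + of_int b * \<theta> | a b. True}"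
      by (auto simp: y_def algebra_simps)
  qed
qed

lemma O_cases:
  assumes "x \<in> \<O>" obtains a b where "x = of_int a + of_int b * \<theta>"
  using assms O_basis by blast

lemma theta_independent:
  "of_int a + of_int b * \<theta> = of_int c + of_int d * \<theta> \<longleftrightarrow> a = c \<and> b = d"
proof
  assume *: "of_int a + of_int b * \<theta> = of_int c + of_int d * \<theta>"
  from arg_cong[OF this, of Im] have "b = d" using theta(2) by simp
  with * show "a = c \<and> b = d" by simp
qed simp

text \<open>Since \<open>discriminant\<close> is a definite description, independence of the basis
  must be shown: the two integral change-of-basis determinants multiply to 1, so each is 1 or -1 and
  disappears on squaring.\<close>

lemma discriminant_theta: "of_int (discriminant K) = (\<theta> - cnj \<theta>)\<^sup>2"
proof -
  define \<delta> where "\<delta> = \<theta> - cnj \<theta>"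
  obtain n :: nat where n: "4 * (Im \<theta>)\<^sup>2 = of_nat n" by (rule O_Im_square[OF theta(1)])
  have "\<delta> = Complex 0 (2 * Im \<theta>)" by (simp add: \<delta>_def complex_eq_iff)
  hence \<delta>2: "\<delta>\<^sup>2 = of_int (- int n)"
    using n by (simp add: complex_eq_iff power2_eq_square Complex_eq)
  have nz: "\<delta> \<noteq> 0" using theta(2) by (auto simp: \<delta>_def complex_eq_iff)
  let ?Q = "\<lambda>d. \<exists>w1 w2.
     (\<forall>a b :: int. of_int a * w1 + of_int b * w2 = 0 \<longrightarrow> a = 0 \<and> b = 0) \<and>
     integers_of K = {of_int a * w1 + of_int b * w2 | a b :: int. True} \<and>
     of_int d = (w1 * cnj w2 - w2 * cnj w1)\<^sup>2"
  have "?Q (- int n)"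
  proof (rule exI[of _ 1], rule exI[of _ \<theta>], intro conjI allI impI)
    show "integers_of K = {of_int a * 1 + of_int b * \<theta> | a b :: int. True}"
      unfolding mult_1_right by (rule O_basis)
    show "of_int (- int n) = (1 * cnj \<theta> - \<theta> * cnj 1)\<^sup>2"
      unfolding \<delta>2[symmetric] by (simp add: \<delta>_def power2_commute)
    fix a b :: int assume "of_int a * 1 + of_int b * \<theta> = 0"
    thus "a = 0" "b = 0" using theta_independent[of a b 0 0] by auto
  qed
  moreover have "d = - int n"
    if O: "\<O> = {of_int a * w1 + of_int b * w2 | a b :: int. True}"
      and d: "of_int d = (w1 * cnj w2 - w2 * cnj w1)\<^sup>2" for d w1 w2
  proof -
    have "of_int 1 * w1 + of_int 0 * w2 \<in> \<O>" "of_int 0 * w1 + of_int 1 * w2 \<in> \<O>"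
      unfolding O by blast+
    hence w12: "w1 \<in> \<O>" "w2 \<in> \<O>" by simp_all
    obtain a b where w1: "w1 = of_int a + of_int b * \<theta>" by (rule O_cases[OF w12(1)])
    obtain c e where w2: "w2 = of_int c + of_int e * \<theta>" by (rule O_cases[OF w12(2)])
    obtain f g where 1: "1 = of_int f * w1 + of_int g * w2"
      using O_1 unfolding O by blast
    obtain h k where th: "\<theta> = of_int h * w1 + of_int k * w2"
      using theta(1) unfolding O by blast
    define \<epsilon> where "\<epsilon> = w1 * cnj w2 - w2 * cnj w1"
    have \<epsilon>: "\<epsilon> = - of_int (a * e - b * c) * \<delta>"
      unfolding \<epsilon>_def w1 w2 \<delta>_def by (simp add: algebra_simps)
    have "\<theta> * cnj 1 - 1 * cnj \<theta> = - of_int (f * k - g * h) * \<epsilon>"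
    proof -
      have c1: "of_int f * cnj w1 + of_int g * cnj w2 = 1"
        using arg_cong[OF 1, of cnj] by simp
      have cth: "of_int h * cnj w1 + of_int k * cnj w2 = cnj \<theta>"
        using arg_cong[OF th, of cnj] by simp
      have "(of_int h * w1 + of_int k * w2) * (of_int f * cnj w1 + of_int g * cnj w2)
          - (of_int f * w1 + of_int g * w2) * (of_int h * cnj w1 + of_int k * cnj w2)
          = - of_int (f * k - g * h) * \<epsilon>"
        unfolding \<epsilon>_def by (simp add: algebra_simps)
      thus ?thesis unfolding c1 cth 1[symmetric] th[symmetric] by simp
    qed
    hence "\<delta> = of_int ((f * k - g * h) * (a * e - b * c)) * \<delta>"
      unfolding \<epsilon> \<delta>_def[symmetric] complex_cnj_one mult_1_right mult_1_left
      by (simp only: of_int_mult mult_minus_left mult_minus_right minus_minus mult.assoc)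
    hence "of_int ((f * k - g * h) * (a * e - b * c)) = (1 :: complex)"
      using nz mult_cancel_right1 by metis
    hence "(f * k - g * h) * (a * e - b * c) = 1"
      by (simp only: of_int_eq_1_iff)
    hence "a * e - b * c = 1 \<or> a * e - b * c = - 1"
      using zmult_eq_1_iff by blast
    hence "\<epsilon>\<^sup>2 = \<delta>\<^sup>2" unfolding \<epsilon>
      by (elim disjE) (simp_all only: of_int_1 of_int_minus, simp_all)
    thus ?thesis using d \<delta>2 unfolding \<epsilon>_def by (metis of_int_eq_iff)
  qed
  ultimately have "discriminant K = - int n"
    unfolding discriminant_def by (intro the_equality) (assumption, elim exE conjE)
  thus ?thesis using \<delta>2 by (simp add: \<delta>_def)
qed

lemma discriminant_Im_theta: "real_of_int (discriminant K) = - (2 * Im \<theta>)\<^sup>2"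
  using discriminant_theta by (simp add: complex_eq_iff power2_eq_square)

lemma sqrt_disc_theta: "sqrt_disc K = \<theta> - cnj \<theta>"
  using theta(2) by (simp add: sqrt_disc_def discriminant_Im_theta complex_eq_iff real_sqrt_mult)

end

section \<open>Fractional ideals\<close>

text \<open>\<open>ideal_prod\<close> is generated inductively from products by addition. Hence
  commutativity, associativity and compatibility with scaling and conjugation hold below for
  arbitrary sets of complex numbers.\<close>

lemma ideal_prod_subsetI:
  assumes "\<And>i j. i \<in> I \<Longrightarrow> j \<in> J \<Longrightarrow> i * j \<in> L" "\<And>x y. x \<in> L \<Longrightarrow> y \<in> L \<Longrightarrow> x + y \<in> L"
  shows "ideal_prod complex_ring I J \<subseteq> L"
proof
  fix x assume "x \<in> ideal_prod complex_ring I J"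
  thus "x \<in> L" by induction (use assms in auto)
qed

lemma ideal_prod_mult: "i \<in> I \<Longrightarrow> j \<in> J \<Longrightarrow> i * j \<in> ideal_prod complex_ring I J"
  using ideal_prod.prod[of i I j J complex_ring] by simp

lemma ideal_prod_add:
  "x \<in> ideal_prod complex_ring I J \<Longrightarrow> y \<in> ideal_prod complex_ring I J \<Longrightarrow>
     x + y \<in> ideal_prod complex_ring I J"
  using ideal_prod.sum[of x complex_ring I J y] by simp

lemma ideal_prod_commute_complex: "ideal_prod complex_ring I J = ideal_prod complex_ring J I"
proof -
  have "ideal_prod complex_ring I J \<subseteq> ideal_prod complex_ring J I" for I J
    by (intro ideal_prod_subsetI ideal_prod_add) (metis ideal_prod_mult mult.commute)
  thus ?thesis by blast
qed

lemma ideal_prod_mult_left: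
  assumes "\<And>i. i \<in> I \<Longrightarrow> a * i \<in> I'" "x \<in> ideal_prod complex_ring I J"
  shows "a * x \<in> ideal_prod complex_ring I' J"
  using assms(2)
proof induction
  case (prod i j)
  thus ?case using ideal_prod_mult[of "a * i" I' j J] assms(1) by (simp add: mult.assoc)
next
  case (sum s t)
  thus ?case using ideal_prod_add by (simp add: distrib_left)
qed

lemma ideal_prod_assoc_subset:
  "ideal_prod complex_ring (ideal_prod complex_ring I J) L \<subseteq>
     ideal_prod complex_ring I (ideal_prod complex_ring J L)"
proof (rule ideal_prod_subsetI)
  fix x l assume "x \<in> ideal_prod complex_ring I J" and l: "l \<in> L"
  thus "x * l \<in> ideal_prod complex_ring I (ideal_prod complex_ring J L)"
  proof induction
    case (prod i j)
    thus ?case using ideal_prod_mult[of i I "j * l" "ideal_prod complex_ring J L"]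
        ideal_prod_mult[of j J l L] by (simp add: mult.assoc)
  next
    case (sum s t)
    thus ?case using ideal_prod_add by (simp add: distrib_right)
  qed
qed (rule ideal_prod_add)

lemma ideal_prod_assoc_complex:
  "ideal_prod complex_ring (ideal_prod complex_ring I J) L =
     ideal_prod complex_ring I (ideal_prod complex_ring J L)"
  using ideal_prod_assoc_subset[of I J L] ideal_prod_assoc_subset[of L J I]
  by (metis ideal_prod_commute_complex subset_antisym)

lemma ideal_prod_scale:
  fixes x :: complex
  shows "ideal_prod complex_ring ((*) x ` I) J = (*) x ` ideal_prod complex_ring I J"
proof
  show "ideal_prod complex_ring ((*) x ` I) J \<subseteq> (*) x ` ideal_prod complex_ring I J"
  proof (rule ideal_prod_subsetI)
    fix i j assume "i \<in> (*) x ` I" "j \<in> J"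
    thus "i * j \<in> (*) x ` ideal_prod complex_ring I J"
      using ideal_prod_mult[of _ I j J] by (auto simp: mult.assoc)
  next
    fix i j assume "i \<in> (*) x ` ideal_prod complex_ring I J" "j \<in> (*) x ` ideal_prod complex_ring I J"
    thus "i + j \<in> (*) x ` ideal_prod complex_ring I J"
      using ideal_prod_add[of _ I J] by (auto simp flip: distrib_left)
  qed
  show "(*) x ` ideal_prod complex_ring I J \<subseteq> ideal_prod complex_ring ((*) x ` I) J"
    using ideal_prod_mult_left[of I x "(*) x ` I" _ J] by auto
qed

lemma ideal_prod_cnj:
  "cnj ` ideal_prod complex_ring I J = ideal_prod complex_ring (cnj ` I) (cnj ` J)"
proof
  have *: "cnj ` ideal_prod complex_ring I J \<subseteq> ideal_prod complex_ring (cnj ` I) (cnj ` J)" for I J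
  proof safe
    fix x assume "x \<in> ideal_prod complex_ring I J"
    thus "cnj x \<in> ideal_prod complex_ring (cnj ` I) (cnj ` J)"
      by induction (auto intro!: ideal_prod_mult ideal_prod_add)
  qed
  thus "cnj ` ideal_prod complex_ring I J \<subseteq> ideal_prod complex_ring (cnj ` I) (cnj ` J)" .
  have "cnj ` ideal_prod complex_ring (cnj ` I) (cnj ` J) \<subseteq> ideal_prod complex_ring I J"
    using *[of "cnj ` I" "cnj ` J"] by (simp add: image_image)
  hence "cnj ` cnj ` ideal_prod complex_ring (cnj ` I) (cnj ` J) \<subseteq> cnj ` ideal_prod complex_ring I J"
    by blast
  thus "ideal_prod complex_ring (cnj ` I) (cnj ` J) \<subseteq> cnj ` ideal_prod complex_ring I J"
    by (simp add: image_image)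
qed

context imaginary_quadratic
begin

abbreviation ideal_times (infixl "\<odot>" 70) where "I \<odot> J \<equiv> ideal_prod complex_ring I J"

abbreviation "fid \<equiv> fractional_ideal K"

lemma fracD:
  assumes "fid I"
  shows "I \<subseteq> K" "0 \<in> I" "I \<noteq> {0}"
    "\<And>x y. x \<in> I \<Longrightarrow> y \<in> I \<Longrightarrow> x + y \<in> I" "\<And>a x. a \<in> \<O> \<Longrightarrow> x \<in> I \<Longrightarrow> a * x \<in> I"
  using assms by (auto simp: fractional_ideal_def)

lemma frac_nonzero:
  assumes "fid I" obtains x where "x \<in> I" "x \<noteq> 0"
  using fracD[OF assms] by blast

lemma frac_denom:
  assumes "fid I" obtains c where "c \<in> \<O>" "c \<noteq> 0" "(*) c ` I \<subseteq> \<O>"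
  using assms unfolding fractional_ideal_def by blast

lemma frac_int_mult: "fid I \<Longrightarrow> x \<in> I \<Longrightarrow> of_int n * x \<in> I"
  using fracD(5) O_of_int by blast

lemma frac_diff: "fid I \<Longrightarrow> x \<in> I \<Longrightarrow> y \<in> I \<Longrightarrow> x - y \<in> I"
  using fracD(4)[of I x "- y"] frac_int_mult[of I y "- 1"] by simp

lemma fracI:
  assumes "I \<subseteq> K" "0 \<in> I" "x \<in> I" "x \<noteq> 0"
    "\<And>x y. x \<in> I \<Longrightarrow> y \<in> I \<Longrightarrow> x + y \<in> I" "\<And>a x. a \<in> \<O> \<Longrightarrow> x \<in> I \<Longrightarrow> a * x \<in> I"
    "c \<in> \<O>" "c \<noteq> 0" "(*) c ` I \<subseteq> \<O>"
  shows "fid I"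
  unfolding fractional_ideal_def
proof (intro conjI ballI bexI[of _ c])
  show "I \<noteq> {0}" using assms(3,4) by blast
  show "c * y \<in> \<O>" if "y \<in> I" for y using assms(9) that by blast
qed (use assms in simp_all)

lemma frac_O: "fid \<O>"
  by (rule fracI[of _ 1 1]) (auto intro: O_in_K)

lemma frac_times [intro]:
  assumes I: "fid I" and J: "fid J"
  shows "fid (I \<odot> J)"
proof -
  obtain x where x: "x \<in> I" "x \<noteq> 0" by (rule frac_nonzero[OF I])
  obtain y where y: "y \<in> J" "y \<noteq> 0" by (rule frac_nonzero[OF J])
  obtain c where c: "c \<in> \<O>" "c \<noteq> 0" "(*) c ` I \<subseteq> \<O>" by (rule frac_denom[OF I])
  obtain d where d: "d \<in> \<O>" "d \<noteq> 0" "(*) d ` J \<subseteq> \<O>" by (rule frac_denom[OF J])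
  show ?thesis
  proof (rule fracI[of _ "x * y" "c * d"])
    show "I \<odot> J \<subseteq> K"
      using fracD(1)[OF I] fracD(1)[OF J] by (intro ideal_prod_subsetI) auto
    show "0 \<in> I \<odot> J"
      using ideal_prod_mult[of 0 I 0 J] fracD(2) I J by simp
    show "x * y \<in> I \<odot> J" "x * y \<noteq> 0" "c * d \<in> \<O>" "c * d \<noteq> 0"
      using x y c d by (auto intro: ideal_prod_mult)
    show "a * x \<in> I \<odot> J" if "a \<in> \<O>" "x \<in> I \<odot> J" for a x
      using ideal_prod_mult_left[of I a I x J] that fracD(5)[OF I] by blast
    have "I \<odot> J \<subseteq> {x. (c * d) * x \<in> \<O>}"
    proof (rule ideal_prod_subsetI)
      fix i j assume "i \<in> I" "j \<in> J"
      hence "(c * i) * (d * j) \<in> \<O>" using c d by blast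
      thus "i * j \<in> {x. (c * d) * x \<in> \<O>}" by (simp add: mult_ac)
    qed (auto simp: distrib_left)
    thus "(*) (c * d) ` (I \<odot> J) \<subseteq> \<O>" by auto
  qed (rule ideal_prod_add)
qed

lemma frac_scale [intro]:
  assumes x: "x \<in> K" "x \<noteq> 0" and I: "fid I"
  shows "fid ((*) x ` I)"
proof -
  obtain y where y: "y \<in> I" "y \<noteq> 0" by (rule frac_nonzero[OF I])
  obtain c where c: "c \<in> \<O>" "c \<noteq> 0" "(*) c ` I \<subseteq> \<O>" by (rule frac_denom[OF I])
  obtain d :: int where d: "d > 0" "of_int d * x \<in> \<O>" by (rule K_denom[OF x(1)])
  show ?thesis
  proof (rule fracI[of _ "x * y" "c * of_int d"])
    show "(*) x ` I \<subseteq> K" using x fracD(1)[OF I] by auto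
    show "0 \<in> (*) x ` I" using fracD(2)[OF I] by force
    show "x * y \<in> (*) x ` I" "x * y \<noteq> 0" "c * of_int d \<in> \<O>" "c * of_int d \<noteq> 0"
      using x y c d by auto
    show "u + v \<in> (*) x ` I" if "u \<in> (*) x ` I" "v \<in> (*) x ` I" for u v
      using that fracD(4)[OF I] by (auto simp flip: distrib_left)
    show "a * u \<in> (*) x ` I" if "a \<in> \<O>" "u \<in> (*) x ` I" for a u
      using that fracD(5)[OF I] by (auto simp: mult.left_commute)
    show "(*) (c * of_int d) ` (*) x ` I \<subseteq> \<O>"
    proof safe
      fix i assume "i \<in> I"
      hence "(c * i) * (of_int d * x) \<in> \<O>" using c d by blast
      thus "c * of_int d * (x * i) \<in> \<O>" by (simp add: mult_ac)
    qed
  qed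
qed

lemma frac_cnj [intro]:
  assumes I: "fid I"
  shows "fid (cnj ` I)"
proof -
  obtain y where y: "y \<in> I" "y \<noteq> 0" by (rule frac_nonzero[OF I])
  obtain c where c: "c \<in> \<O>" "c \<noteq> 0" "(*) c ` I \<subseteq> \<O>" by (rule frac_denom[OF I])
  show ?thesis
  proof (rule fracI[of _ "cnj y" "cnj c"])
    show "cnj ` I \<subseteq> K" using fracD(1)[OF I] by auto
    show "0 \<in> cnj ` I" using fracD(2)[OF I] by force
    show "cnj y \<in> cnj ` I" "cnj y \<noteq> 0" "cnj c \<in> \<O>" "cnj c \<noteq> 0"
      using y c by auto
    show "u + v \<in> cnj ` I" if "u \<in> cnj ` I" "v \<in> cnj ` I" for u v
      using that fracD(4)[OF I] by (auto simp flip: complex_cnj_add)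
    show "a * u \<in> cnj ` I" if au: "a \<in> \<O>" "u \<in> cnj ` I" for a u
    proof -
      obtain v where v: "v \<in> I" "u = cnj v" using au by blast
      have "cnj a * v \<in> I" using fracD(5)[OF I] O_cnj[OF au(1)] v by blast
      moreover have "a * u = cnj (cnj a * v)" using v by simp
      ultimately show ?thesis by blast
    qed
    show "(*) (cnj c) ` cnj ` I \<subseteq> \<O>"
    proof safe
      fix i assume "i \<in> I"
      hence "cnj (c * i) \<in> \<O>" using c by blast
      thus "cnj c * cnj i \<in> \<O>" by simp
    qed
  qed
qed

lemma O_times:
  assumes "fid I" shows "\<O> \<odot> I = I"
proof
  show "\<O> \<odot> I \<subseteq> I" using fracD[OF assms] by (intro ideal_prod_subsetI) auto
  show "I \<subseteq> \<O> \<odot> I" using ideal_prod_mult[of 1 \<O> _ I] by auto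
qed

lemma times_O: "fid I \<Longrightarrow> I \<odot> \<O> = I"
  using O_times ideal_prod_commute_complex by metis

lemma cnj_image_O: "cnj ` \<O> = \<O>"
  using O_cnj by (force intro: image_eqI[of _ _ "cnj x" for x])

lemma scale_O_times: "fid I \<Longrightarrow> ((*) x ` \<O>) \<odot> I = (*) x ` I"
  by (simp add: ideal_prod_scale O_times)

text \<open>Hermite normal form: a is the least positive integer in I and c the least positive
  \<theta>-coefficient. Division with remainder by c and then by a reduces every element to
  0.\<close>

lemma integral_ideal_basis:
  assumes I: "fid I" and sub: "I \<subseteq> \<O>"
  obtains a b c :: int where "a > 0" "c > 0"
    "I = {of_int x * of_int a + of_int y * (of_int b + of_int c * \<theta>) | x y. True}"
proof -
  define P where "P n \<longleftrightarrow> n > 0 \<and> of_nat n \<in> I" for n :: nat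
  define Q where "Q n \<longleftrightarrow> n > 0 \<and> (\<exists>b::int. of_int b + of_nat n * \<theta> \<in> I)" for n :: nat
  obtain z where z: "z \<in> I" "z \<noteq> 0" by (rule frac_nonzero[OF I])
  have "z \<in> \<O>" using z sub by blast
  then obtain n where n: "z * cnj z = of_int n" using O_trace_norm by (auto elim!: Ints_cases)
  have "of_int n = cnj z * z" using n by (simp add: mult.commute)
  also have "\<dots> \<in> I" using fracD(5)[OF I O_cnj[OF \<open>z \<in> \<O>\<close>] z(1)] .
  finally have nI: "of_int n \<in> I" .
  have "real_of_int n = (cmod z)\<^sup>2"
    using n by (metis complex_norm_square of_real_eq_iff of_real_of_int_eq)
  hence "n > 0" using z by (metis of_int_0_less_iff zero_less_norm_iff zero_less_power)
  hence "P (nat n)" using nI by (simp add: P_def)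
  define a where "a = (LEAST n. P n)"
  have a: "P a" unfolding a_def by (rule LeastI[of P]) fact
  have a_least: "a \<le> n" if "P n" for n unfolding a_def using that by (rule Least_le)
  have "of_int 0 + of_nat a * \<theta> \<in> I"
    using fracD(5)[OF I theta(1), of "of_nat a"] a by (simp add: P_def mult.commute)
  hence "Q a" using a unfolding Q_def P_def by blast
  define c where "c = (LEAST n. Q n)"
  have c: "Q c" unfolding c_def by (rule LeastI[of Q]) fact
  have c_least: "c \<le> n" if "Q n" for n unfolding c_def using that by (rule Least_le)
  obtain b :: int where b: "of_int b + of_nat c * \<theta> \<in> I" using c by (auto simp: Q_def)
  let ?L = "{of_int x * of_int (int a) + of_int y * (of_int b + of_int (int c) * \<theta>) | x y. True}"
  have "?L \<subseteq> I"
    using a b fracD(4)[OF I] frac_int_mult[OF I] by (auto simp: P_def)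
  moreover have "I \<subseteq> ?L"
  proof
    fix w assume w: "w \<in> I"
    then obtain u v where uv: "w = of_int u + of_int v * \<theta>" using sub O_cases by blast
    define y where "y = v div int c"
    define w' where "w' = w - of_int y * (of_int b + of_nat c * \<theta>)"
    have w': "w' \<in> I" unfolding w'_def using w b frac_diff[OF I] frac_int_mult[OF I] by blast
    have v: "v = y * int c + v mod int c" unfolding y_def by simp
    have w'_eq: "w' = of_int (u - y * b) + of_int (v mod int c) * \<theta>"
      unfolding w'_def uv by (subst v) (simp add: algebra_simps del: div_mult_mod_eq mult_div_mod_eq)
    have "v mod int c = 0"
    proof (rule ccontr)
      assume nz: "v mod int c \<noteq> 0"
      have cpos: "int c > 0" using c by (simp add: Q_def)
      hence pos: "v mod int c > 0" "v mod int c < int c"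
        using nz pos_mod_sign[OF cpos, of v] pos_mod_bound[OF cpos, of v] by linarith+
      have "Q (nat (v mod int c))"
        unfolding Q_def using pos w' w'_eq by (auto simp del: of_int_diff of_int_mult)
      thus False using c_least[of "nat (v mod int c)"] pos by linarith
    qed
    hence w'_int: "of_int (u - y * b) \<in> I" using w' w'_eq by simp
    define x where "x = (u - y * b) div int a"
    define m where "m = (u - y * b) mod int a"
    have xm: "u - y * b = x * int a + m" unfolding x_def m_def by simp
    have "of_int m = of_int (u - y * b) - of_int x * (of_nat a :: complex)"
      unfolding xm by simp
    also have "\<dots> \<in> I" using w'_int a frac_diff[OF I] frac_int_mult[OF I] by (simp add: P_def)
    finally have mI: "of_int m \<in> I" .
    have "m = 0"
    proof (rule ccontr)
      assume nz: "m \<noteq> 0"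
      have apos: "int a > 0" using a by (simp add: P_def)
      hence pos: "m > 0" "m < int a"
        using nz pos_mod_sign[OF apos, of "u - y * b"] pos_mod_bound[OF apos, of "u - y * b"]
        unfolding m_def by linarith+
      have "P (nat m)" unfolding P_def using pos mI by simp
      thus False using a_least[of "nat m"] pos by linarith
    qed
    have "w = of_int (u - y * b) + of_int y * (of_int b + of_int (int c) * \<theta>)"
      using w'_eq \<open>v mod int c = 0\<close> unfolding w'_def by (simp add: algebra_simps)
    hence "w = of_int x * of_int (int a) + of_int y * (of_int b + of_int (int c) * \<theta>)"
      unfolding xm \<open>m = 0\<close> by simp
    thus "w \<in> ?L" by blast
  qed
  ultimately show ?thesis using a c by (intro that[of "int a" "int c" b]) (auto simp: P_def Q_def)
qed

section \<open>Norms of ideals\<close>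

lemma O_of_int_divideI:
  assumes "x \<in> K" "g \<noteq> 0" "x + cnj x = of_int t" "x * cnj x = of_int n" "g dvd t" "g * g dvd n"
  shows "x / of_int g \<in> \<O>"
proof -
  obtain t' n' where t': "t = g * t'" and n': "n = g * g * n'" using assms(5,6) by (auto elim!: dvdE)
  have "x / of_int g + cnj (x / of_int g) = (x + cnj x) / of_int g"
    by (simp add: add_divide_distrib)
  also have "\<dots> = of_int t'" unfolding assms(3) t' using assms(2) by simp
  finally have 1: "x / of_int g + cnj (x / of_int g) \<in> \<int>" by simp
  have "x / of_int g * cnj (x / of_int g) = (x * cnj x) / (of_int g * of_int g)"
    by simp
  also have "\<dots> = of_int n'" unfolding assms(4) n' using assms(2) by simp
  finally have 2: "x / of_int g * cnj (x / of_int g) \<in> \<int>" by simp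
  show ?thesis unfolding O_iff using 1 2 assms(1) K_of_int by blast
qed

text \<open>Hurwitz's argument: \<open>\<alpha> * cnj \<beta> / g\<close> is an algebraic integer, where \<open>g\<close> is the greatest
  common divisor of the norms and of the mixed trace of the basis elements \<open>\<alpha>, \<beta>\<close>.\<close>

lemma integral_times_cnj:
  assumes I: "fid I" and sub: "I \<subseteq> \<O>" and "a > 0" "c > 0"
    and basis: "I = {of_int x * of_int a + of_int y * (of_int b + of_int c * \<theta>) | x y. True}"
  shows "I \<odot> cnj ` I = (*) (of_int (a * c)) ` \<O>"
proof -
  define \<beta> where "\<beta> = of_int b + of_int c * \<theta>"
  have \<beta>O: "\<beta> \<in> \<O>" unfolding \<beta>_def using theta(1) by blast
  obtain nB where nB: "\<beta> * cnj \<beta> = of_int nB" using O_trace_norm[OF \<beta>O] by (auto elim!: Ints_cases)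
  obtain tB where tB: "\<beta> + cnj \<beta> = of_int tB" using O_trace_norm[OF \<beta>O] by (auto elim!: Ints_cases)
  define g where "g = gcd (a * a) (gcd nB (a * tB))"
  have g: "g > 0" using \<open>a > 0\<close> by (simp add: g_def)
  have gdvd: "g dvd a * a" "g dvd nB" "g dvd a * tB"
    unfolding g_def by (meson dvd_trans gcd_dvd1 gcd_dvd2)+
  define \<eta> where "\<eta> = of_int a * cnj \<beta> / of_int g"
  have g\<eta>: "of_int g * \<eta> = of_int a * cnj \<beta>" using g by (simp add: \<eta>_def)
  have g\<eta>': "of_int g * cnj \<eta> = of_int a * \<beta>" using arg_cong[OF g\<eta>, of cnj] by simp
  have \<eta>O: "\<eta> \<in> \<O>" unfolding \<eta>_def
  proof (rule O_of_int_divideI)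
    show "of_int a * cnj \<beta> \<in> K" using O_in_K[OF O_cnj[OF \<beta>O]] K_of_int by blast
    show "of_int a * cnj \<beta> + cnj (of_int a * cnj \<beta>) = of_int (a * tB)"
      using tB by (simp add: distrib_left[symmetric] add.commute)
    show "of_int a * cnj \<beta> * cnj (of_int a * cnj \<beta>) = of_int (a * a * nB)"
      using nB by (simp add: mult_ac)
    show "g * g dvd a * a * nB" using gdvd by (intro mult_dvd_mono)
  qed (use g gdvd in auto)
  \<comment> \<open>The proof closes the circle of inclusions I * cnj I <= \<open>L\<close> <= g
    \<O> <= I * cnj I; only integer coefficients are allowed in \<open>L\<close>, which makes the
    later comparison of imaginary parts possible.\<close>
  define L where "L = {of_int g * (of_int p + of_int m * \<eta> + of_int n * cnj \<eta>) | p m n. True}"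
  have prod_L: "I \<odot> cnj ` I \<subseteq> L"
  proof (rule ideal_prod_subsetI)
    fix i j assume "i \<in> I" "j \<in> cnj ` I"
    then obtain x y z w where i: "i = of_int x * of_int a + of_int y * \<beta>"
      and j: "j = of_int z * of_int a + of_int w * cnj \<beta>"
      unfolding basis \<beta>_def by auto
    obtain p q where p: "a * a = g * p" and q: "nB = g * q"
      using gdvd by (auto elim!: dvdE)
    have "i * j = of_int (x * z * (a * a)) + of_int (y * w) * (\<beta> * cnj \<beta>)
        + of_int (x * w) * (of_int a * cnj \<beta>) + of_int (y * z) * (of_int a * \<beta>)"
      unfolding i j by (simp add: algebra_simps)
    also have "\<dots> = of_int g * (of_int (x * z * p + y * w * q) + of_int (x * w) * \<eta> + of_int (y * z) * cnj \<eta>)"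
      unfolding nB g\<eta>[symmetric] g\<eta>'[symmetric] p q by (simp add: algebra_simps)
    finally show "i * j \<in> L" unfolding L_def by blast
  next
    fix x y assume "x \<in> L" "y \<in> L"
    then obtain p m n p' m' n' where
      "x = of_int g * (of_int p + of_int m * \<eta> + of_int n * cnj \<eta>)"
      "y = of_int g * (of_int p' + of_int m' * \<eta> + of_int n' * cnj \<eta>)"
      unfolding L_def by blast
    hence "x + y = of_int g * (of_int (p + p') + of_int (m + m') * \<eta> + of_int (n + n') * cnj \<eta>)"
      by (simp add: algebra_simps)
    thus "x + y \<in> L" unfolding L_def by blast
  qed
  have L_O: "L \<subseteq> (*) (of_int g) ` \<O>"
    unfolding L_def using \<eta>O O_cnj[OF \<eta>O] by (auto intro!: imageI)
  have J: "fid (I \<odot> cnj ` I)" using I by blast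
  have aI: "of_int a \<in> I" unfolding basis by (rule CollectI, rule exI[of _ 1], rule exI[of _ 0]) simp
  have \<beta>I: "\<beta> \<in> I" unfolding basis \<beta>_def by (rule CollectI, rule exI[of _ 0], rule exI[of _ 1]) simp
  have "of_int a * cnj (of_int a) \<in> I \<odot> cnj ` I" "\<beta> * cnj \<beta> \<in> I \<odot> cnj ` I"
    "of_int a * cnj \<beta> + \<beta> * cnj (of_int a) \<in> I \<odot> cnj ` I"
    using aI \<beta>I by (blast intro: ideal_prod_mult ideal_prod_add)+
  moreover have "of_int a * cnj (of_int a) = (of_int (a * a) :: complex)" by simp
  moreover have "of_int a * cnj \<beta> + \<beta> * cnj (of_int a) = of_int (a * tB)"
    unfolding of_int_mult tB[symmetric] by (simp add: algebra_simps)
  ultimately have in_J: "of_int (a * a) \<in> I \<odot> cnj ` I" "of_int nB \<in> I \<odot> cnj ` I"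
    "of_int (a * tB) \<in> I \<odot> cnj ` I"
    unfolding nB by metis+
  \<comment> \<open>Norms and mixed trace of the generators lie in I * cnj I, hence by Bezout so
    does their greatest common divisor g.\<close>
  obtain u v where uv: "u * nB + v * (a * tB) = gcd nB (a * tB)" using bezout_int by blast
  obtain r s where rs: "r * (a * a) + s * gcd nB (a * tB) = g" unfolding g_def using bezout_int by blast
  have "of_int g = of_int r * of_int (a * a) + of_int s * (of_int u * of_int nB + of_int v * (of_int (a * tB) :: complex))"
    unfolding rs[symmetric] uv[symmetric] by (simp del: of_int_mult) simp
  also have "\<dots> \<in> I \<odot> cnj ` I"
    using in_J by (intro fracD(4)[OF J] frac_int_mult[OF J])
  finally have gJ: "of_int g \<in> I \<odot> cnj ` I" .
  hence gO_J: "(*) (of_int g) ` \<O> \<subseteq> I \<odot> cnj ` I"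
    using fracD(5)[OF J _ gJ] by (auto simp: mult.commute)
  \<comment> \<open>It remains to identify g with a * c. Imaginary parts decide it: \<theta> is an
    integral combination of 1, \<eta> and its conjugate, so a * c divides g; conversely \<eta> is an
    integral combination of 1 and \<theta>, so g divides a * c.\<close>
  have "of_int g * \<theta> \<in> L" using gO_J prod_L theta(1) by blast
  then obtain p m n where "of_int g * \<theta> = of_int g * (of_int p + of_int m * \<eta> + of_int n * cnj \<eta>)"
    unfolding L_def by blast
  hence th: "\<theta> = of_int p + of_int m * \<eta> + of_int n * cnj \<eta>" using g by simp
  have Im\<eta>: "of_int g * Im \<eta> = - (of_int (a * c) * Im \<theta>)"
    using arg_cong[OF g\<eta>, of Im] by (simp add: \<beta>_def)
  have "Im \<theta> = of_int (m - n) * Im \<eta>" using arg_cong[OF th, of Im] by (simp add: algebra_simps)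
  hence "of_int g * Im \<theta> = of_int (m - n) * (of_int g * Im \<eta>)" by simp
  also have "\<dots> = of_int ((n - m) * (a * c)) * Im \<theta>" unfolding Im\<eta> by (simp add: algebra_simps)
  finally have "real_of_int g = of_int ((n - m) * (a * c))" using theta(2) by (metis less_irrefl mult_right_cancel)
  hence "g = (n - m) * (a * c)" by (simp only: of_int_eq_iff)
  hence 1: "a * c dvd g" by simp
  obtain p' q' where "\<eta> = of_int p' + of_int q' * \<theta>" by (rule O_cases[OF \<eta>O])
  hence "of_int g * (of_int q' * Im \<theta>) = - (of_int (a * c) * Im \<theta>)"
    using Im\<eta> by simp
  hence "of_int (g * (- q')) * Im \<theta> = of_int (a * c) * Im \<theta>" by (simp add: algebra_simps)
  hence "real_of_int (g * (- q')) = of_int (a * c)" using theta(2) by (metis less_irrefl mult_right_cancel)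
  hence "g * (- q') = a * c" by (simp only: of_int_eq_iff)
  hence 2: "g dvd a * c" by (metis dvd_triv_left)
  have "a * c \<ge> 0" using \<open>a > 0\<close> \<open>c > 0\<close> by simp
  with zdvd_antisym_nonneg[OF _ _ 2 1] g have "g = a * c" by linarith
  thus ?thesis using prod_L L_O gO_J by blast
qed

lemma coset_carrier:
  "carrier (integer_ring K Quot I) = (\<lambda>x. (\<lambda>i. i + x) ` I) ` \<O>"
  by (auto simp: integer_ring_def FactRing_def A_RCOSETS_def' a_r_coset_def r_coset_def image_def
      ring_of_type_algebra_def)

lemma coset_eq_iff:
  assumes I: "fid I"
  shows "(\<lambda>i. i + x) ` I = (\<lambda>i. i + y) ` I \<longleftrightarrow> x - y \<in> I"
proof
  assume "(\<lambda>i. i + x) ` I = (\<lambda>i. i + y) ` I"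
  moreover have "0 + x \<in> (\<lambda>i. i + x) ` I" using fracD(2)[OF I] by blast
  ultimately obtain i where "i \<in> I" "x = i + y" by auto
  thus "x - y \<in> I" by simp
next
  have *: "(\<lambda>i. i + x) ` I \<subseteq> (\<lambda>i. i + y) ` I" if "x - y \<in> I" for x y
  proof safe
    fix i assume "i \<in> I"
    hence "i + (x - y) \<in> I" using fracD(4)[OF I] that by blast
    moreover have "i + x = i + (x - y) + y" by simp
    ultimately show "i + x \<in> (\<lambda>i. i + y) ` I" by blast
  qed
  assume "x - y \<in> I"
  moreover from this have "y - x \<in> I" using frac_int_mult[OF I, of "x - y" "- 1"] by simp
  ultimately show "(\<lambda>i. i + x) ` I = (\<lambda>i. i + y) ` I" using * by blast
qed

text \<open>The basis is triangular, so the points of the box [0, a) x [0, c) represent each coset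
  exactly once: reduce the \<theta>-coordinate modulo c, then the other one modulo a.\<close>

lemma ideal_norm_basis:
  assumes I: "fid I" and "a > 0" "c > 0"
    and basis: "I = {of_int x * of_int a + of_int y * (of_int b + of_int c * \<theta>) | x y. True}"
  shows "int (ideal_norm K I) = a * c"
proof -
  have mem: "of_int u + of_int v * \<theta> \<in> I \<longleftrightarrow> (\<exists>x y. u = x * a + y * b \<and> v = y * c)" for u v
  proof
    assume "of_int u + of_int v * \<theta> \<in> I"
    then obtain x y where "of_int u + of_int v * \<theta> = of_int (x * a + y * b) + of_int (y * c) * \<theta>"
      unfolding basis by (auto simp: algebra_simps)
    thus "\<exists>x y. u = x * a + y * b \<and> v = y * c" unfolding theta_independent by blast
  next
    assume "\<exists>x y. u = x * a + y * b \<and> v = y * c"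
    then obtain x y where "u = x * a + y * b" "v = y * c" by blast
    thus "of_int u + of_int v * \<theta> \<in> I"
      unfolding basis by (intro CollectI exI[of _ x] exI[of _ y]) (simp add: algebra_simps)
  qed
  define f where "f = (\<lambda>(u :: int, v :: int). (\<lambda>i. i + (of_int u + of_int v * \<theta>)) ` I)"
  have f_eq: "f (u, v) = f (u', v') \<longleftrightarrow> (\<exists>x y. u - u' = x * a + y * b \<and> v - v' = y * c)" for u v u' v'
  proof -
    have "(of_int u + of_int v * \<theta>) - (of_int u' + of_int v' * \<theta>) = of_int (u - u') + of_int (v - v') * \<theta>"
      by (simp add: algebra_simps)
    thus ?thesis unfolding f_def by (simp only: prod.case coset_eq_iff[OF I] mem)
  qed
  have small: "x = 0" if "\<bar>x * n\<bar> < n" for x n :: int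
    using that by (metis abs_mult abs_ge_self abs_of_pos le_less_trans less_irrefl linorder_not_le mult_le_cancel_right1 mult_zero_left zero_less_abs_iff int_one_le_iff_zero_less abs_ge_zero order_less_le_trans)
  have "inj_on f ({0..<a} \<times> {0..<c})"
  proof (rule inj_onI, clarify)
    fix u v u' v' assume uv: "u \<in> {0..<a}" "v \<in> {0..<c}" "u' \<in> {0..<a}" "v' \<in> {0..<c}"
      and "f (u, v) = f (u', v')"
    then obtain x y where xy: "u - u' = x * a + y * b" "v - v' = y * c" unfolding f_eq by blast
    have "\<bar>v - v'\<bar> < c" using uv by auto
    hence "y = 0" unfolding xy by (rule small)
    moreover have "\<bar>u - u'\<bar> < a" using uv by auto
    hence "x = 0" unfolding xy \<open>y = 0\<close> mult_zero_left add_0_right by (rule small)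
    ultimately show "u = u' \<and> v = v'" using xy by simp
  qed
  moreover have "f ` ({0..<a} \<times> {0..<c}) = carrier (integer_ring K Quot I)"
  proof
    show "f ` ({0..<a} \<times> {0..<c}) \<subseteq> carrier (integer_ring K Quot I)"
      unfolding coset_carrier f_def using theta(1) by auto
    show "carrier (integer_ring K Quot I) \<subseteq> f ` ({0..<a} \<times> {0..<c})"
    proof
      fix A assume "A \<in> carrier (integer_ring K Quot I)"
      then obtain w where "w \<in> \<O>" "A = (\<lambda>i. i + w) ` I" unfolding coset_carrier by blast
      then obtain u v where A: "A = f (u, v)" unfolding f_def using O_cases by (metis prod.case)
      define y where "y = v div c"
      define x where "x = (u - y * b) div a"
      have "f (u, v) = f ((u - y * b) mod a, v mod c)"
        unfolding f_eq by (intro exI[of _ x] exI[of _ y])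
          (simp add: x_def y_def minus_mod_eq_div_mult[symmetric] algebra_simps)
      moreover have "((u - y * b) mod a, v mod c) \<in> {0..<a} \<times> {0..<c}"
        using \<open>a > 0\<close> \<open>c > 0\<close> by simp
      ultimately show "A \<in> f ` ({0..<a} \<times> {0..<c})" unfolding A by blast
    qed
  qed
  ultimately have "ideal_norm K I = card ({0..<a} \<times> {0..<c})"
    unfolding ideal_norm_def by (metis card_image)
  thus ?thesis using \<open>a > 0\<close> \<open>c > 0\<close> by simp
qed

section \<open>Norm and inverse of a fractional ideal\<close>

definition fid_norm :: "complex set \<Rightarrow> real" where
  "fid_norm I = (THE g. g > 0 \<and> I \<odot> cnj ` I = (*) (of_real g) ` \<O>)"

text \<open>The quotient g / h is a real element of \<O>, hence a positive integer. Used in both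
  directions, this makes \<open>fid_norm\<close> well defined.\<close>

lemma real_scale_O_subset:
  assumes "g > 0" "h > 0" "(*) (of_real g) ` \<O> \<subseteq> (*) (of_real h) ` \<O>"
  shows "h \<le> g"
proof -
  obtain x where x: "x \<in> \<O>" "of_real g * 1 = of_real h * x" using assms(3) by blast
  have "x = of_real (g / h)" using x(2) assms(2) by (simp add: field_simps)
  hence "of_real (g / h) \<in> (\<int> :: complex set)" using O_real_Ints[OF x(1)] x by auto
  then obtain n where "complex_of_real (g / h) = of_int n" by (auto elim: Ints_cases)
  hence n: "g / h = of_int n" by (metis of_real_eq_iff of_real_of_int_eq)
  moreover have "g / h > 0" using assms by simp
  ultimately have "g / h \<ge> 1" by simp
  thus ?thesis using assms by (simp add: field_simps)
qed

lemma fid_norm_eqI: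
  assumes "g > 0" "I \<odot> cnj ` I = (*) (of_real g) ` \<O>"
  shows "fid_norm I = g"
  unfolding fid_norm_def using assms real_scale_O_subset
  by (intro the_equality) (auto intro!: antisym)

lemma integral_norm:
  assumes "fid I" "I \<subseteq> \<O>"
  shows "ideal_norm K I > 0" "I \<odot> cnj ` I = (*) (of_nat (ideal_norm K I)) ` \<O>"
proof -
  obtain a b c where abc: "a > 0" "c > 0"
    "I = {of_int x * of_int a + of_int y * (of_int b + of_int c * \<theta>) | x y. True}"
    using integral_ideal_basis[OF assms] by metis
  have n: "int (ideal_norm K I) = a * c" by (rule ideal_norm_basis[OF assms(1) abc])
  hence "of_nat (ideal_norm K I) = (of_int (a * c) :: complex)" by (metis of_int_of_nat_eq)
  thus "I \<odot> cnj ` I = (*) (of_nat (ideal_norm K I)) ` \<O>"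
    using integral_times_cnj[OF assms abc] by simp
  have "a * c > 0" using abc by simp
  thus "ideal_norm K I > 0" using n by linarith
qed

lemma fid_norm_integral: "fid I \<Longrightarrow> I \<subseteq> \<O> \<Longrightarrow> fid_norm I = real (ideal_norm K I)"
  using integral_norm[of I] by (intro fid_norm_eqI) auto

lemma cnj_scale: "cnj ` ((*) x ` I) = (*) (cnj x) ` cnj ` I"
  by (auto simp: image_image)

lemma scale_scale: "(*) x ` (*) y ` I = (*) (x * y :: complex) ` I"
  by (auto simp: image_image mult.assoc)

lemma ideal_prod_scale2: "I \<odot> ((*) x ` J) = (*) x ` (I \<odot> J)"
  by (metis ideal_prod_commute_complex ideal_prod_scale)

lemma scale_norm:
  assumes "I \<odot> cnj ` I = (*) (of_real g) ` \<O>"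
  shows "((*) x ` I) \<odot> cnj ` ((*) x ` I) = (*) (of_real ((cmod x)\<^sup>2 * g)) ` \<O>"
proof -
  have "cnj x * (x * of_real g) = of_real ((cmod x)\<^sup>2 * g)"
    using complex_norm_square[of x] by (simp add: mult_ac)
  thus ?thesis
    by (simp only: cnj_scale ideal_prod_scale ideal_prod_scale2 assms scale_scale mult.assoc)
qed

lemma fid_norm_exists:
  assumes "fid I" shows "\<exists>g>0. I \<odot> cnj ` I = (*) (of_real g) ` \<O>"
proof -
  obtain c where c: "c \<in> \<O>" "c \<noteq> 0" "(*) c ` I \<subseteq> \<O>" by (rule frac_denom[OF assms])
  have J: "fid ((*) c ` I)" using assms c O_in_K by blast
  define n where "n = ideal_norm K ((*) c ` I)"
  have n: "n > 0" "(*) c ` I \<odot> cnj ` (*) c ` I = (*) (of_real (of_nat n)) ` \<O>"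
    using integral_norm[OF J c(3)] by (simp_all add: n_def)
  have "(*) (inverse c) ` (*) c ` I = I" using c unfolding scale_scale by simp
  with scale_norm[OF n(2), of "inverse c"] have
    "I \<odot> cnj ` I = (*) (of_real ((cmod (inverse c))\<^sup>2 * of_nat n)) ` \<O>" by simp
  moreover have "(cmod (inverse c))\<^sup>2 * of_nat n > 0" using c n by simp
  ultimately show ?thesis by blast
qed

lemma fid_norm:
  assumes "fid I" shows "fid_norm I > 0" "I \<odot> cnj ` I = (*) (of_real (fid_norm I)) ` \<O>"
  using fid_norm_exists[OF assms] fid_norm_eqI by metis+

lemma fid_norm_scale:
  assumes "fid I" "x \<noteq> 0" shows "fid_norm ((*) x ` I) = (cmod x)\<^sup>2 * fid_norm I"
  using fid_norm[OF assms(1)] assms(2) by (intro fid_norm_eqI scale_norm) auto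

lemma fid_norm_cnj:
  assumes "fid I" shows "fid_norm (cnj ` I) = fid_norm I"
  using fid_norm[OF assms(1)] ideal_prod_commute_complex[of I "cnj ` I"]
  by (intro fid_norm_eqI) (simp_all add: image_image)

lemma fid_norm_times:
  assumes "fid I" "fid J" shows "fid_norm (I \<odot> J) = fid_norm I * fid_norm J"
proof (rule fid_norm_eqI)
  show "fid_norm I * fid_norm J > 0" using fid_norm(1) assms by simp
  have "(I \<odot> J) \<odot> cnj ` (I \<odot> J) = (I \<odot> cnj ` I) \<odot> (J \<odot> cnj ` J)"
    unfolding ideal_prod_cnj by (metis ideal_prod_assoc_complex ideal_prod_commute_complex)
  also have "\<dots> = (*) (of_real (fid_norm I * fid_norm J)) ` \<O>"
    unfolding fid_norm(2)[OF assms(1)] fid_norm(2)[OF assms(2)] ideal_prod_scale ideal_prod_scale2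
      scale_scale by (simp add: O_times[OF frac_O] mult.commute)
  finally show "(I \<odot> J) \<odot> cnj ` (I \<odot> J) = (*) (of_real (fid_norm I * fid_norm J)) ` \<O>" .
qed

text \<open>As 1 is in \<O>, the norm is itself an element of I * cnj I. Membership in
  \<open>K\<close> permits scaling ideals by its inverse.\<close>

lemma fid_norm_Rats: "fid I \<Longrightarrow> of_real (fid_norm I) \<in> K"
  using fid_norm(2)[of I] fracD(1)[OF frac_times[OF _ frac_cnj], of I I] O_1 by force

definition fid_inv :: "complex set \<Rightarrow> complex set" where
  "fid_inv I = (*) (inverse (of_real (fid_norm I))) ` cnj ` I"

lemma fid_inv [intro]:
  assumes "fid I" shows "fid (fid_inv I)"
  unfolding fid_inv_def using assms fid_norm_Rats[OF assms] fid_norm(1)[OF assms]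
  by (intro frac_scale frac_cnj K_inverse) auto

lemma times_fid_inv:
  assumes "fid I" shows "I \<odot> fid_inv I = \<O>" "fid_inv I \<odot> I = \<O>"
proof -
  show "I \<odot> fid_inv I = \<O>"
    using fid_norm(1)[OF assms]
    unfolding fid_inv_def ideal_prod_scale2 fid_norm(2)[OF assms] scale_scale by simp
  thus "fid_inv I \<odot> I = \<O>" by (simp only: ideal_prod_commute_complex)
qed

section \<open>Class group, prime factors and ambiguous ideals\<close>

lemma ideal_prod_mono: "I \<subseteq> I' \<Longrightarrow> J \<subseteq> J' \<Longrightarrow> I \<odot> J \<subseteq> I' \<odot> J'"
  by (intro ideal_prod_subsetI ideal_prod_add) (auto intro: ideal_prod_mult)

lemma integral_times_subset: "fid I \<Longrightarrow> J \<subseteq> \<O> \<Longrightarrow> I \<odot> J \<subseteq> I"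
  using ideal_prod_mono[of I I J \<O>] times_O[of I] by simp

lemma times_fid_inv_cancel:
  assumes "fid I" "fid J"
  shows "I \<odot> (fid_inv I \<odot> J) = J" "fid_inv I \<odot> (I \<odot> J) = J"
  using times_fid_inv[OF assms(1)] O_times[OF assms(2)]
  by (simp_all flip: ideal_prod_assoc_complex)

text \<open>To contain is to divide: the quotient I / J is an integral ideal.\<close>

lemma fid_inv_times_integral: "fid J \<Longrightarrow> I \<subseteq> J \<Longrightarrow> fid_inv J \<odot> I \<subseteq> \<O>"
  using ideal_prod_mono[of "fid_inv J" "fid_inv J" I J] times_fid_inv(2)[of J] by simp

text \<open>Norm 1 gives \<O> = I * cnj I, and this product is contained in I.\<close>

lemma integral_eq_O:
  assumes "fid I" "I \<subseteq> \<O>" "ideal_norm K I = 1"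
  shows "I = \<O>"
proof -
  have "\<O> = I \<odot> cnj ` I" using integral_norm(2)[OF assms(1,2)] assms(3) by simp
  moreover have "cnj ` I \<subseteq> \<O>" using assms(2) by blast
  hence "I \<odot> cnj ` I \<subseteq> I" using integral_times_subset assms by blast
  ultimately show ?thesis using assms(2) by blast
qed

lemma ideal_norm_times:
  assumes "fid I" "I \<subseteq> \<O>" "fid J" "J \<subseteq> \<O>"
  shows "ideal_norm K (I \<odot> J) = ideal_norm K I * ideal_norm K J"
proof -
  have "I \<odot> J \<subseteq> \<O>" using integral_times_subset assms by blast
  hence "real (ideal_norm K (I \<odot> J)) = fid_norm (I \<odot> J)"
    using fid_norm_integral assms by (metis frac_times)
  thus ?thesis
    using fid_norm_times fid_norm_integral assms by (metis of_nat_mult of_nat_eq_iff)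
qed

section \<open>The class group as a quotient of the group of fractional ideals\<close>

abbreviation "\<G> \<equiv> fractional_ideal_group K"

lemma fractional_ideal_group_simps [simp]:
  "carrier \<G> = {I. fid I}" "I \<otimes>\<^bsub>\<G>\<^esub> J = I \<odot> J" "\<one>\<^bsub>\<G>\<^esub> = \<O>"
  by (simp_all add: fractional_ideal_group_def)

lemma comm_group_fractional_ideals: "comm_group \<G>"
proof (rule comm_groupI)
  fix I J assume "I \<in> carrier \<G>" "J \<in> carrier \<G>"
  show "I \<otimes>\<^bsub>\<G>\<^esub> J = J \<otimes>\<^bsub>\<G>\<^esub> I" by (simp add: ideal_prod_commute_complex)
next
  fix I assume "I \<in> carrier \<G>"
  thus "\<exists>J\<in>carrier \<G>. J \<otimes>\<^bsub>\<G>\<^esub> I = \<one>\<^bsub>\<G>\<^esub>"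
    by (intro bexI[of _ "fid_inv I"]) (auto simp: times_fid_inv)
qed (auto simp: frac_O O_times ideal_prod_assoc_complex)

lemma principal_fid: "x \<in> K \<Longrightarrow> x \<noteq> 0 \<Longrightarrow> fid ((*) x ` \<O>)"
  using frac_scale frac_O by blast

lemma subgroup_principal: "subgroup (principal_fractional_ideals K) \<G>"
proof -
  interpret comm_group \<G> by (rule comm_group_fractional_ideals)
  show ?thesis
  proof (rule subgroupI)
    show "principal_fractional_ideals K \<subseteq> carrier \<G>"
      using principal_fid by (auto simp: principal_fractional_ideals_def)
    show "principal_fractional_ideals K \<noteq> {}"
      using K_1 by (auto simp: principal_fractional_ideals_def)
    fix I assume "I \<in> principal_fractional_ideals K"
    then obtain x where x: "x \<in> K" "x \<noteq> 0" "I = (*) x ` \<O>"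
      by (auto simp: principal_fractional_ideals_def)
    have "((*) (inverse x) ` \<O>) \<odot> I = \<O>"
      unfolding x(3) scale_O_times[OF principal_fid[OF x(1,2)]] scale_scale using x(2) by simp
    hence "inv\<^bsub>\<G>\<^esub> I = (*) (inverse x) ` \<O>"
      using x principal_fid[of x] principal_fid[of "inverse x"] by (intro inv_equality) auto
    thus "inv\<^bsub>\<G>\<^esub> I \<in> principal_fractional_ideals K"
      using x by (auto simp: principal_fractional_ideals_def)
    fix J assume "J \<in> principal_fractional_ideals K"
    then obtain y where y: "y \<in> K" "y \<noteq> 0" "J = (*) y ` \<O>"
      by (auto simp: principal_fractional_ideals_def)
    have "I \<odot> J = (*) (x * y) ` \<O>"
      unfolding x(3) scale_O_times[OF principal_fid[OF y(1,2)], folded y(3)] unfolding y(3) scale_scale ..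
    moreover have "x * y \<in> K - {0}" using x y by auto
    ultimately show "I \<otimes>\<^bsub>\<G>\<^esub> J \<in> principal_fractional_ideals K"
      unfolding principal_fractional_ideals_def by auto
  qed
qed

lemma normal_principal: "principal_fractional_ideals K \<lhd> \<G>"
  by (intro comm_group.subgroup_imp_normal comm_group_fractional_ideals subgroup_principal)

lemma group_class_group: "group (class_group K)"
  unfolding class_group_def by (rule normal.factorgroup_is_group[OF normal_principal])

lemma carrier_class_group: "carrier (class_group K) = ideal_class K ` {I. fid I}"
  unfolding class_group_def carrier_FactGroup by (simp add: ideal_class_def)

lemma ideal_class_eq: "fid I \<Longrightarrow> ideal_class K I = {(*) x ` I | x. x \<in> K \<and> x \<noteq> 0}"
  by (auto simp: ideal_class_def r_coset_def principal_fractional_ideals_def scale_O_times)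

lemma ideal_class_times:
  assumes "fid I" "fid J"
  shows "ideal_class K I \<otimes>\<^bsub>class_group K\<^esub> ideal_class K J = ideal_class K (I \<odot> J)"
  using normal.rcos_sum[OF normal_principal, of I J] assms
  by (simp add: class_group_def ideal_class_def)

lemma ideal_class_one: "\<one>\<^bsub>class_group K\<^esub> = ideal_class K \<O>"
proof -
  have "ideal_class K \<O> = principal_fractional_ideals K"
    unfolding ideal_class_eq[OF frac_O] principal_fractional_ideals_def by auto
  thus ?thesis by (simp add: class_group_def)
qed

lemma ideal_class_scale:
  assumes "fid I" "x \<in> K" "x \<noteq> 0"
  shows "ideal_class K ((*) x ` I) = ideal_class K I"
proof -
  have "(*) y ` I = (*) (y / x) ` (*) x ` I" for y unfolding scale_scale using assms by simp
  moreover have "y / x \<in> K \<and> y / x \<noteq> 0" if "y \<in> K" "y \<noteq> 0" for y using that assms by auto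
  ultimately have "ideal_class K I \<subseteq> ideal_class K ((*) x ` I)"
    unfolding ideal_class_eq[OF assms(1)] ideal_class_eq[OF frac_scale[OF assms(2,3,1)]] by blast
  moreover have "ideal_class K ((*) x ` I) \<subseteq> ideal_class K I"
    unfolding ideal_class_eq[OF assms(1)] ideal_class_eq[OF frac_scale[OF assms(2,3,1)]]
    using assms unfolding scale_scale by fastforce
  ultimately show ?thesis by blast
qed

section \<open>Integral ideals, prime factors and generated classes\<close>

lemma integer_ring_simps [simp]:
  "carrier (integer_ring K) = \<O>" "x \<otimes>\<^bsub>integer_ring K\<^esub> y = x * y" "\<one>\<^bsub>integer_ring K\<^esub> = 1"
  "\<zero>\<^bsub>integer_ring K\<^esub> = 0" "x \<oplus>\<^bsub>integer_ring K\<^esub> y = x + y"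
  by (simp_all add: integer_ring_def ring_of_type_algebra_def)

lemma cring_integer_ring: "cring (integer_ring K)"
proof (rule cringI)
  show "abelian_group (integer_ring K)"
  proof (rule abelian_groupI)
    fix x assume "x \<in> carrier (integer_ring K)"
    thus "\<exists>y\<in>carrier (integer_ring K). y \<oplus>\<^bsub>integer_ring K\<^esub> x = \<zero>\<^bsub>integer_ring K\<^esub>"
      by (intro bexI[of _ "- x"]) auto
  qed auto
  show "comm_monoid (integer_ring K)"
    by (rule comm_monoidI) auto
qed (auto simp: distrib_right)

lemma ideal_of_fid:
  assumes "fid I" "I \<subseteq> \<O>"
  shows "ideal I (integer_ring K)"
proof -
  interpret R: cring "integer_ring K" by (rule cring_integer_ring)
  have neg: "\<ominus>\<^bsub>integer_ring K\<^esub> x = - x" if "x \<in> \<O>" for x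
    using R.minus_equality[of "- x" x] that by auto
  have "- x \<in> I" if "x \<in> I" for x
    using frac_int_mult[OF assms(1) that, of "- 1"] by simp
  hence "subgroup I (add_monoid (integer_ring K))"
    using assms neg fracD(2,4)[OF assms(1)]
    by (intro R.add.subgroupI) (auto simp: a_inv_def[symmetric])
  thus ?thesis
  proof (intro idealI R.ring_axioms)
    fix a x assume "a \<in> I" "x \<in> carrier (integer_ring K)"
    thus "x \<otimes>\<^bsub>integer_ring K\<^esub> a \<in> I" "a \<otimes>\<^bsub>integer_ring K\<^esub> x \<in> I"
      using fracD(5)[OF assms(1), of x a] by (simp_all add: mult.commute)
  qed
qed

lemma fid_of_ideal:
  assumes "ideal I (integer_ring K)" "I \<noteq> {0}"
  shows "fid I" "I \<subseteq> \<O>"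
proof -
  interpret ideal I "integer_ring K" by fact
  show sub: "I \<subseteq> \<O>" using a_subset by simp
  have "0 \<in> I" using additive_subgroup.zero_closed[OF is_additive_subgroup] by simp
  then obtain x where x: "x \<in> I" "x \<noteq> 0" using assms(2) by blast
  show "fid I"
  proof (rule fracI[of I x 1])
    show "u + v \<in> I" if "u \<in> I" "v \<in> I" for u v
      using additive_subgroup.a_closed[OF is_additive_subgroup, of u v] that by simp
    show "a * u \<in> I" if "a \<in> \<O>" "u \<in> I" for a u using I_l_closed[of u a] that by simp
    show "(*) 1 ` I \<subseteq> \<O>" using sub by simp
  qed (use sub O_in_K x \<open>0 \<in> I\<close> in auto)
qed

text \<open>The greatest common divisor of two ideals.\<close>

definition fid_sum :: "complex set \<Rightarrow> complex set \<Rightarrow> complex set" where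
  "fid_sum I J = {i + j | i j. i \<in> I \<and> j \<in> J}"

lemma fid_sum_subset:
  assumes "fid I" "fid J" shows "I \<subseteq> fid_sum I J" "J \<subseteq> fid_sum I J"
  using fracD(2)[OF assms(1)] fracD(2)[OF assms(2)] unfolding fid_sum_def by force+

lemma fid_sum_integral: "I \<subseteq> \<O> \<Longrightarrow> J \<subseteq> \<O> \<Longrightarrow> fid_sum I J \<subseteq> \<O>"
  unfolding fid_sum_def by blast

lemma fid_fid_sum:
  assumes "fid I" "fid J" "I \<subseteq> \<O>" "J \<subseteq> \<O>"
  shows "fid (fid_sum I J)"
proof -
  obtain x where x: "x \<in> I" "x \<noteq> 0" by (rule frac_nonzero[OF assms(1)])
  show ?thesis
  proof (rule fracI[of _ x 1])
    show "x \<in> fid_sum I J" using x fid_sum_subset[OF assms(1,2)] by blast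
    show "0 \<in> fid_sum I J" using fracD(2)[OF assms(1)] fid_sum_subset[OF assms(1,2)] by blast
    show "u + v \<in> fid_sum I J" if "u \<in> fid_sum I J" "v \<in> fid_sum I J" for u v
    proof -
      obtain i j i' j' where "i \<in> I" "j \<in> J" "i' \<in> I" "j' \<in> J" "u = i + j" "v = i' + j'"
        using \<open>u \<in> _\<close> \<open>v \<in> _\<close> unfolding fid_sum_def by blast
      moreover from this have "u + v = (i + i') + (j + j')" by simp
      ultimately show ?thesis
        using fracD(4)[OF assms(1)] fracD(4)[OF assms(2)] unfolding fid_sum_def by blast
    qed
    show "a * u \<in> fid_sum I J" if "a \<in> \<O>" "u \<in> fid_sum I J" for a u
    proof -
      obtain i j where "i \<in> I" "j \<in> J" "u = i + j" using \<open>u \<in> _\<close> unfolding fid_sum_def by blast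
      moreover from this have "a * u = a * i + a * j" by (simp add: distrib_left)
      ultimately show ?thesis
        using fracD(5)[OF assms(1) \<open>a \<in> \<O>\<close>] fracD(5)[OF assms(2) \<open>a \<in> \<O>\<close>]
        unfolding fid_sum_def by blast
    qed
  qed (use fid_sum_integral[OF assms(3,4)] O_in_K x in auto)
qed

text \<open>I is J times the integral ideal I / J, whose norm exceeds 1 because it differs from
  \<O>. This makes the norm a measure for maximality and induction.\<close>

lemma ideal_norm_less:
  assumes "fid I" "fid J" "I \<subseteq> J" "J \<subseteq> \<O>" "I \<noteq> J"
  shows "ideal_norm K J < ideal_norm K I"
proof -
  define L where "L = fid_inv J \<odot> I"
  have L: "fid L" "L \<subseteq> \<O>" "J \<odot> L = I"
    using assms fid_inv_times_integral times_fid_inv_cancel unfolding L_def by auto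
  have "ideal_norm K I = ideal_norm K J * ideal_norm K L"
    using ideal_norm_times[of J L] assms L by simp
  moreover have "ideal_norm K L \<noteq> 1"
    using integral_eq_O[OF L(1,2)] L(3) times_O[OF assms(2)] assms(5) by metis
  ultimately show ?thesis
    using integral_norm(1)[OF L(1,2)] integral_norm(1)[OF assms(2,4)] by simp
qed

text \<open>A proper integral ideal of least norm above I is maximal, since enlarging it would lower
  the norm. Primality then follows from 1 = p + b x whenever b lies outside P.\<close>

lemma prime_factor_exists:
  assumes I: "fid I" "I \<subseteq> \<O>" "I \<noteq> \<O>"
  obtains P where "primeideal P (integer_ring K)" "fid P" "P \<subseteq> \<O>" "P \<noteq> \<O>" "I \<subseteq> P"
proof -
  let ?Q = "\<lambda>J. fid J \<and> I \<subseteq> J \<and> J \<subseteq> \<O> \<and> J \<noteq> \<O>"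
  obtain P where P: "?Q P" and min: "\<And>J. ?Q J \<Longrightarrow> ideal_norm K P \<le> ideal_norm K J"
    using ex_has_least_nat[of ?Q I "ideal_norm K"] I by auto
  have max: "J = \<O>" if "fid J" "P \<subseteq> J" "J \<subseteq> \<O>" "P \<noteq> J" for J
    using ideal_norm_less[of P J] min[of J] that P by fastforce
  have "primeideal P (integer_ring K)"
  proof (rule primeidealI)
    show "ideal P (integer_ring K)" "cring (integer_ring K)" "carrier (integer_ring K) \<noteq> P"
      using P ideal_of_fid cring_integer_ring by auto
    fix a b assume "a \<in> carrier (integer_ring K)" "b \<in> carrier (integer_ring K)"
      "a \<otimes>\<^bsub>integer_ring K\<^esub> b \<in> P"
    hence ab: "a \<in> \<O>" "b \<in> \<O>" "a * b \<in> P" by simp_all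
    show "a \<in> P \<or> b \<in> P"
    proof (rule disjCI)
      assume "b \<notin> P"
      hence "b \<noteq> 0" using P fracD(2) by blast
      define J where "J = fid_sum P ((*) b ` \<O>)"
      have bO: "fid ((*) b ` \<O>)" "(*) b ` \<O> \<subseteq> \<O>"
        using ab \<open>b \<noteq> 0\<close> O_in_K principal_fid by auto
      have J: "fid J" "P \<subseteq> J" "J \<subseteq> \<O>"
        unfolding J_def using fid_fid_sum fid_sum_subset fid_sum_integral P bO by auto
      have "b \<in> (*) b ` \<O>" using O_1 by force
      hence "b \<in> J" unfolding J_def using fid_sum_subset(2) P bO by blast
      hence "J = \<O>" using max J \<open>b \<notin> P\<close> by blast
      then obtain p x where px: "p \<in> P" "x \<in> \<O>" "1 = p + b * x"
        using O_1 unfolding J_def fid_sum_def by blast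
      have "a = a * (p + b * x)" using px(3) by simp
      also have "\<dots> = a * p + x * (a * b)" by (simp add: algebra_simps)
      also have "\<dots> \<in> P" using P px ab fracD(4,5) by blast
      finally show "a \<in> P" .
    qed
  qed
  thus ?thesis using that P by blast
qed

text \<open>Strong induction on the norm: split off a prime factor; by multiplicativity the norms of
  both factors still divide n, and the cofactor has smaller norm.\<close>

lemma ideal_class_in_generate:
  assumes "fid I" "I \<subseteq> \<O>" "ideal_norm K I dvd n"
    and gen: "\<And>P. primeideal P (integer_ring K) \<Longrightarrow> P \<noteq> {0} \<Longrightarrow> ideal_norm K P dvd n \<Longrightarrow> ideal_class K P \<in> S"
  shows "ideal_class K I \<in> generate (class_group K) S"
  using assms(1-3)
proof (induction "ideal_norm K I" arbitrary: I rule: less_induct)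
  case less
  show ?case
  proof (cases "I = \<O>")
    case True
    thus ?thesis using generate.one[of "class_group K" S] by (simp add: ideal_class_one)
  next
    case False
    obtain P where P: "primeideal P (integer_ring K)" "fid P" "P \<subseteq> \<O>" "P \<noteq> \<O>" "I \<subseteq> P"
      using prime_factor_exists[OF less.prems(1,2) False] by metis
    define J where "J = fid_inv P \<odot> I"
    have J: "fid J" "J \<subseteq> \<O>" "P \<odot> J = I"
      using less.prems P fid_inv_times_integral times_fid_inv_cancel unfolding J_def by auto
    have n: "ideal_norm K I = ideal_norm K P * ideal_norm K J"
      using ideal_norm_times P J by metis
    have "ideal_norm K P > 1"
      using integral_norm(1)[OF P(2,3)] integral_eq_O[OF P(2,3)] P(4) by linarith
    hence "ideal_norm K J < ideal_norm K I"
      unfolding n using integral_norm(1)[OF J(1,2)] by simp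
    moreover have "ideal_norm K J dvd n" "ideal_norm K P dvd n"
      using less.prems(3) unfolding n by (auto intro: dvd_mult_left dvd_mult_right)
    ultimately have "ideal_class K J \<in> generate (class_group K) S" "ideal_class K P \<in> S"
      using less.hyps J gen P fracD(3)[OF P(2)] by blast+
    hence "ideal_class K P \<otimes>\<^bsub>class_group K\<^esub> ideal_class K J \<in> generate (class_group K) S"
      by (blast intro: generate.eng generate.incl)
    thus ?thesis using ideal_class_times P J by metis
  qed
qed

text \<open>Cancelling I between I * I = x \<O> and I * cnj I = N(I) \<O> gives cnj I = y I.
  Equality of norms gives |y| = 1, and Hilbert 90 for the quadratic extension supplies z with y = z
  / cnj z.\<close>

lemma ambiguous_ideal_in_class:
  assumes I: "fid I" and sq: "I \<odot> I = (*) x ` \<O>" and x: "x \<in> K" "x \<noteq> 0"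
  obtains z where "z \<in> K" "z \<noteq> 0" "cnj ` ((*) z ` I) = (*) z ` I"
proof -
  define y where "y = of_real (fid_norm I) / x"
  have y: "y \<in> K" "y \<noteq> 0"
    using x fid_norm_Rats[OF I] fid_norm(1)[OF I] by (auto simp: y_def)
  have "I \<odot> cnj ` I = I \<odot> ((*) y ` I)"
    unfolding ideal_prod_scale2 sq scale_scale fid_norm(2)[OF I] using x by (simp add: y_def)
  hence cnjI: "cnj ` I = (*) y ` I"
    using times_fid_inv_cancel(2)[OF I] I y by (metis frac_cnj frac_scale)
  have "fid_norm I = (cmod y)\<^sup>2 * fid_norm I"
    using fid_norm_scale[OF I y(2)] fid_norm_cnj[OF I] cnjI by simp
  hence "(cmod y)\<^sup>2 = 1" using fid_norm(1)[OF I] by simp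
  hence yy: "cnj y * y = 1" using complex_norm_square[of y]
    by (metis mult.commute of_real_1)
  \<comment> \<open>If |y| = 1, then cnj (1 + y) * y = 1 + y. This z vanishes for y = -1, where any
    nonzero purely imaginary element of \<open>K\<close> serves instead.\<close>
  define z where "z = (if y = - 1 then \<theta> - cnj \<theta> else 1 + y)"
  have "\<theta> - cnj \<theta> \<noteq> 0" using theta(2) by (auto simp: complex_eq_iff)
  hence z: "z \<in> K" "z \<noteq> 0"
    using y O_in_K[OF theta(1)] K_1 by (auto simp: z_def add_eq_0_iff)
  have "cnj z * y = z" using yy by (auto simp: z_def algebra_simps)
  hence "cnj ` ((*) z ` I) = (*) z ` I"
    unfolding cnj_scale cnjI scale_scale by simp
  thus ?thesis using that z by blast
qed

text \<open>Dividing out the rational integer c leaves a lattice spanned by a' and b' + \<theta>, of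
  norm a'. It contains the trace and the norm of b' + \<theta> because it is closed under
  conjugation, so a' divides both, and the discriminant is trace^2 - 4 * norm.\<close>

lemma ambiguous_primitive:
  assumes I: "fid I" "I \<subseteq> \<O>" and amb: "cnj ` I = I"
  obtains c where "c \<in> K" "c \<noteq> 0" "(*) c ` I \<subseteq> \<O>" "int (ideal_norm K ((*) c ` I)) dvd discriminant K"
proof -
  obtain a b c where ac: "a > 0" "c > 0"
    and basis: "I = {of_int x * of_int a + of_int y * (of_int b + of_int c * \<theta>) | x y. True}"
    using integral_ideal_basis[OF I] by metis
  have coeff: "c dvd v" if "of_int u + of_int v * \<theta> \<in> I" for u v
  proof -
    from that obtain x y where "of_int u + of_int v * \<theta> = of_int (x * a + y * b) + of_int (y * c) * \<theta>"
      unfolding basis by (auto simp: algebra_simps)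
    thus ?thesis unfolding theta_independent by simp
  qed
  obtain t where t: "\<theta> + cnj \<theta> = of_int t" using O_trace_norm[OF theta(1)] by (auto elim!: Ints_cases)
  obtain n where n: "\<theta> * cnj \<theta> = of_int n" using O_trace_norm[OF theta(1)] by (auto elim!: Ints_cases)
  have "cnj \<theta> = of_int t - \<theta>" using t by (simp add: algebra_simps)
  hence "\<theta> * (of_int t - \<theta>) = of_int n" using n by simp
  hence \<theta>2: "\<theta> * \<theta> = of_int t * \<theta> - of_int n" by (simp add: algebra_simps)
  have aI: "of_int a \<in> I" unfolding basis by (rule CollectI, rule exI[of _ 1], rule exI[of _ 0]) simp
  have \<beta>I: "of_int b + of_int c * \<theta> \<in> I"
    unfolding basis by (rule CollectI, rule exI[of _ 0], rule exI[of _ 1]) simp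
  \<comment> \<open>Multiplying both generators by \<theta> stays in I; since c divides every
    \<theta>-coefficient occurring in I, it divides a and then b.\<close>
  have "of_int 0 + of_int a * \<theta> \<in> I" using fracD(5)[OF I(1) theta(1) aI] by (simp add: mult.commute)
  then obtain a' where a': "a = c * a'" using coeff by blast
  have "\<theta> * (of_int b + of_int c * \<theta>) = of_int b * \<theta> + of_int c * (\<theta> * \<theta>)"
    by (simp add: algebra_simps)
  also have "\<dots> = of_int (- (c * n)) + of_int (b + c * t) * \<theta>" unfolding \<theta>2 by (simp add: algebra_simps)
  finally have "of_int (- (c * n)) + of_int (b + c * t) * \<theta> \<in> I"
    using fracD(5)[OF I(1) theta(1) \<beta>I] by simp
  hence "c dvd b + c * t" by (rule coeff)
  then obtain b' where b': "b = c * b'" by (metis dvd_add_left_iff dvd_def dvd_triv_left)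
  define J where "J = (*) (inverse (of_int c)) ` I"
  have cK: "inverse (of_int c) \<in> K" "inverse (of_int c :: complex) \<noteq> 0"
    using ac K_of_int by auto
  have J: "fid J" unfolding J_def using cK I by blast
  have J_basis: "J = {of_int x * of_int a' + of_int y * (of_int b' + of_int 1 * \<theta>) | x y. True}"
  proof -
    have "inverse (of_int c) * (of_int x * of_int a + of_int y * (of_int b + of_int c * \<theta>))
      = of_int x * of_int a' + of_int y * (of_int b' + of_int 1 * \<theta>)" for x y
      using ac unfolding a' b' by (simp add: field_simps)
    thus ?thesis unfolding J_def basis by (auto simp: image_iff) metis+
  qed
  have a'pos: "a' > 0" using ac a' by (simp add: zero_less_mult_iff)
  have JO: "J \<subseteq> \<O>" unfolding J_basis using theta(1) by auto
  have intJ: "a' dvd u" if "of_int u \<in> J" for u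
  proof -
    from that obtain x y where "of_int u + of_int 0 * \<theta> = of_int (x * a' + y * b') + of_int y * \<theta>"
      unfolding J_basis by (auto simp: algebra_simps)
    thus ?thesis unfolding theta_independent by auto
  qed
  have \<gamma>J: "of_int b' + \<theta> \<in> J"
    unfolding J_basis by (rule CollectI, rule exI[of _ 0], rule exI[of _ 1]) simp
  have "cnj ` J = J" unfolding J_def cnj_scale amb by simp
  hence \<gamma>J': "of_int b' + cnj \<theta> \<in> J" using imageI[OF \<gamma>J, of cnj] by simp
  have "of_int (2 * b' + t) = (of_int b' + \<theta>) + (of_int b' + cnj \<theta>)"
    using t by (simp add: algebra_simps)
  hence "of_int (2 * b' + t) \<in> J" using fracD(4)[OF J \<gamma>J \<gamma>J'] by simp
  hence 1: "a' dvd 2 * b' + t" by (rule intJ)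
  have "of_int (b' * b' + b' * t + n) = (of_int b' + \<theta>) * (of_int b' + cnj \<theta>)"
    using n by (simp add: algebra_simps flip: t)
  hence "of_int (b' * b' + b' * t + n) \<in> J" using fracD(5)[OF J _ \<gamma>J'] \<gamma>J JO by auto
  hence 2: "a' dvd b' * b' + b' * t + n" by (rule intJ)
  have "(\<theta> - cnj \<theta>)\<^sup>2 = (\<theta> + cnj \<theta>)\<^sup>2 - 4 * (\<theta> * cnj \<theta>)"
    by (simp add: power2_eq_square algebra_simps)
  also have "\<dots> = of_int ((2 * b' + t) * (2 * b' + t) - 4 * (b' * b' + b' * t + n))"
    unfolding t n by (simp add: power2_eq_square algebra_simps)
  finally have "discriminant K = (2 * b' + t) * (2 * b' + t) - 4 * (b' * b' + b' * t + n)"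
    using discriminant_theta by (metis of_int_eq_iff)
  hence "a' dvd discriminant K" using 1 2 by (metis dvd_diff dvd_mult)
  moreover have "int (ideal_norm K J) = a'"
    using ideal_norm_basis[OF J a'pos _ J_basis] by simp
  ultimately show ?thesis using that cK JO unfolding J_def by blast
qed

lemma order_two_class_representative:
  assumes I: "fid I" and sq: "I \<odot> I = (*) x ` \<O>" and x: "x \<in> K" "x \<noteq> 0"
  obtains w where "w \<in> K" "w \<noteq> 0" "(*) w ` I \<subseteq> \<O>" "int (ideal_norm K ((*) w ` I)) dvd discriminant K"
proof -
  obtain z where z: "z \<in> K" "z \<noteq> 0" "cnj ` ((*) z ` I) = (*) z ` I"
    using ambiguous_ideal_in_class[OF assms] by metis
  have J: "fid ((*) z ` I)" using z I by blast
  obtain d where d: "d \<in> \<O>" "d \<noteq> 0" "(*) d ` (*) z ` I \<subseteq> \<O>" by (rule frac_denom[OF J])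
  \<comment> \<open>The denominator is made real so that clearing it preserves invariance under
    conjugation.\<close>
  define e where "e = cnj d * d"
  have e: "e \<in> \<O>" "e \<noteq> 0" "cnj e = e" using d by (auto simp: e_def mult.commute)
  have "(*) e ` (*) z ` I = (*) (cnj d) ` (*) d ` (*) z ` I" by (simp only: e_def scale_scale mult.assoc)
  also have "\<dots> \<subseteq> \<O>" using d O_cnj[OF d(1)] by blast
  finally have eO: "(*) e ` (*) z ` I \<subseteq> \<O>" .
  have eJ: "fid ((*) e ` (*) z ` I)" using e O_in_K J by blast
  have "cnj ` (*) e ` (*) z ` I = (*) e ` (*) z ` I"
    using cnj_scale[of e "(*) z ` I"] e z by simp
  then obtain c where c: "c \<in> K" "c \<noteq> 0" "(*) c ` (*) e ` (*) z ` I \<subseteq> \<O>"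
    "int (ideal_norm K ((*) c ` (*) e ` (*) z ` I)) dvd discriminant K"
    using ambiguous_primitive[OF eJ eO] by metis
  show ?thesis
  proof (rule that[of "c * (e * z)"])
    show "c * (e * z) \<in> K" "c * (e * z) \<noteq> 0"
      using c e z O_in_K[OF e(1)] by auto
  qed (use c in \<open>simp_all only: scale_scale\<close>)
qed

text \<open>G is the greatest common divisor. The cofactors A and B are coprime of equal norm, so A
  * cnj A = B * cnj B, and coprimality forces B = cnj A.\<close>

lemma equal_norm_conjugate:
  assumes I: "fid I" "I \<subseteq> \<O>" and J: "fid J" "J \<subseteq> \<O>"
    and norm: "ideal_norm K I = ideal_norm K J"
  obtains G A where "fid G" "fid A" "G \<subseteq> \<O>" "A \<subseteq> \<O>" "I = G \<odot> A" "J = G \<odot> cnj ` A"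
proof -
  define G where "G = fid_sum I J"
  have G: "fid G" "G \<subseteq> \<O>" "I \<subseteq> G" "J \<subseteq> G"
    unfolding G_def using fid_fid_sum fid_sum_subset fid_sum_integral I J by auto
  define A where "A = fid_inv G \<odot> I"
  define B where "B = fid_inv G \<odot> J"
  have A: "fid A" "A \<subseteq> \<O>" "G \<odot> A = I" and B: "fid B" "B \<subseteq> \<O>" "G \<odot> B = J"
    using I J G fid_inv_times_integral times_fid_inv_cancel unfolding A_def B_def by auto
  have "ideal_norm K G * ideal_norm K A = ideal_norm K G * ideal_norm K B"
    using ideal_norm_times[OF G(1,2) A(1,2)] ideal_norm_times[OF G(1,2) B(1,2)] A(3) B(3) norm by simp
  hence nAB: "ideal_norm K A = ideal_norm K B" using integral_norm(1)[OF G(1,2)] by simp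
  have AB: "A \<odot> cnj ` A = B \<odot> cnj ` B"
    using integral_norm(2)[OF A(1,2)] integral_norm(2)[OF B(1,2)] nAB by simp
  have "fid_inv G \<odot> G \<subseteq> fid_sum A B"
  proof (rule ideal_prod_subsetI)
    fix k g assume k: "k \<in> fid_inv G" and "g \<in> G"
    then obtain i j where ij: "i \<in> I" "j \<in> J" "g = i + j" unfolding G_def fid_sum_def by blast
    have "k * g = k * i + k * j" using ij by (simp add: distrib_left)
    moreover have "k * i \<in> A" "k * j \<in> B"
      unfolding A_def B_def using k ij by (blast intro: ideal_prod_mult)+
    ultimately show "k * g \<in> fid_sum A B" unfolding fid_sum_def by blast
  qed (use fracD(4)[OF fid_fid_sum[OF A(1) B(1) A(2) B(2)]] in blast)
  hence "1 \<in> fid_sum A B" using times_fid_inv(2)[OF G(1)] O_1 by blast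
  then obtain i j where ij: "i \<in> A" "j \<in> B" "1 = i + j" unfolding fid_sum_def by blast
  \<comment> \<open>For w in cnj B', write w = w i + j w. The first term is in A'; the second is in
    B' * cnj B' = A' * cnj A', hence in A'. The fact is stated generally because it is applied to
    both orders of A and B.\<close>
  have *: "cnj ` B' \<subseteq> A'" if "fid A'" "fid B'" "A' \<subseteq> \<O>" "B' \<subseteq> \<O>" "A' \<odot> cnj ` A' = B' \<odot> cnj ` B'"
    "i \<in> A'" "j \<in> B'" "1 = i + j" for A' B' i j
  proof
    fix w assume w: "w \<in> cnj ` B'"
    have "w \<in> \<O>" using w \<open>B' \<subseteq> \<O>\<close> by blast
    have "w = w * (i + j)" using \<open>1 = i + j\<close> by simp
    also have "\<dots> = w * i + j * w" by (simp add: algebra_simps)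
    also have "j * w \<in> B' \<odot> cnj ` B'" using w \<open>j \<in> B'\<close> by (intro ideal_prod_mult)
    hence "j * w \<in> A' \<odot> cnj ` A'" using that by simp
    hence "j * w \<in> A'" using integral_times_subset[of A' "cnj ` A'"] \<open>fid A'\<close> \<open>A' \<subseteq> \<O>\<close> by blast
    hence "w * i + j * w \<in> A'" using fracD(4,5)[OF \<open>fid A'\<close>] \<open>w \<in> \<O>\<close> \<open>i \<in> A'\<close> by blast
    finally show "w \<in> A'" .
  qed
  have "cnj ` B \<subseteq> A" using *[of A B i j] A B AB ij by simp
  moreover have "cnj ` A \<subseteq> B" using *[of B A j i] A B AB ij by (simp add: add.commute)
  hence "cnj ` cnj ` A \<subseteq> cnj ` B" by blast
  ultimately have "B = cnj ` A" using \<open>cnj ` A \<subseteq> B\<close> by (force simp: image_image)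
  thus ?thesis using that A B G by metis
qed

text \<open>If \<open>C\<^sup>2\<close> and \<open>\<O>\<close> are equivalent to integral ideals of equal norm, written \<open>G * A\<close> and
  \<open>G * cnj A\<close>, then \<open>C / A\<close> has order at most two in the class group.\<close>

lemma class_factorization:
  assumes C: "fid C" and x: "x \<in> K" "x \<noteq> 0" and y: "y \<in> K" "y \<noteq> 0"
    and sub: "(*) x ` (C \<odot> C) \<subseteq> \<O>" "(*) y ` \<O> \<subseteq> \<O>"
    and norm: "ideal_norm K ((*) x ` (C \<odot> C)) = n" "ideal_norm K ((*) y ` \<O>) = n"
  obtains A B where "fid A" "A \<subseteq> \<O>" "ideal_norm K A dvd n" "fid B" "B \<subseteq> \<O>"
    "int (ideal_norm K B) dvd discriminant K" "ideal_class K C = ideal_class K (A \<odot> B)"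
proof -
  have I: "fid ((*) x ` (C \<odot> C))" and J: "fid ((*) y ` \<O>)" using C x y frac_O by blast+
  obtain G A where G: "fid G" "G \<subseteq> \<O>" and A: "fid A" "A \<subseteq> \<O>"
    and IG: "(*) x ` (C \<odot> C) = G \<odot> A" and JG: "(*) y ` \<O> = G \<odot> cnj ` A"
    using equal_norm_conjugate[OF I sub(1) J sub(2)] norm by metis
  have nA: "ideal_norm K A dvd n"
    using ideal_norm_times[OF G A] IG norm(1) by (metis dvd_triv_right)
  define E where "E = C \<odot> fid_inv A"
  have E: "fid E" unfolding E_def using C A by blast
  define g where "g = fid_norm A"
  have g: "of_real g \<in> K" "of_real g \<noteq> (0 :: complex)"
    using fid_norm_Rats[OF A(1)] fid_norm(1)[OF A(1)] by (auto simp: g_def)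
  \<comment> \<open>Multiplying y \<O> = G * cnj A by A gives y A = N(A) G, so G is equivalent to A.
    Hence x (C * C) = G * A is equivalent to A * A, and the square of \<open>E\<close> = C / A is
    principal.\<close>
  have "(*) y ` A = ((*) y ` \<O>) \<odot> A" by (simp add: scale_O_times A)
  also have "\<dots> = G \<odot> (A \<odot> cnj ` A)"
    unfolding JG by (metis ideal_prod_assoc_complex ideal_prod_commute_complex)
  also have "\<dots> = (*) (of_real g) ` G"
    unfolding fid_norm(2)[OF A(1)] g_def[symmetric] ideal_prod_scale2 times_O[OF G(1)] ..
  finally have "(*) (inverse (of_real g)) ` (*) y ` A = (*) (inverse (of_real g)) ` (*) (of_real g) ` G"
    by (rule arg_cong)
  hence GA: "G = (*) (inverse (of_real g) * y) ` A"
    unfolding scale_scale using g by simp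
  have "(*) x ` (E \<odot> E) = ((*) x ` (C \<odot> C)) \<odot> (fid_inv A \<odot> fid_inv A)"
    unfolding E_def ideal_prod_scale by (metis ideal_prod_assoc_complex ideal_prod_commute_complex)
  also have "\<dots> = (*) (inverse (of_real g) * y) ` ((A \<odot> fid_inv A) \<odot> (A \<odot> fid_inv A))"
    unfolding IG GA ideal_prod_scale by (metis ideal_prod_assoc_complex ideal_prod_commute_complex)
  also have "\<dots> = (*) (inverse (of_real g) * y) ` \<O>"
    unfolding times_fid_inv(1)[OF A(1)] O_times[OF frac_O] ..
  finally have "(*) (inverse x) ` (*) x ` (E \<odot> E) = (*) (inverse x) ` (*) (inverse (of_real g) * y) ` \<O>"
    by simp
  hence sq: "E \<odot> E = (*) (inverse x * (inverse (of_real g) * y)) ` \<O>"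
    unfolding scale_scale using x by simp
  have nz: "inverse x * (inverse (of_real g) * y) \<in> K" "inverse x * (inverse (of_real g) * y) \<noteq> 0"
    using x y g by auto
  obtain w where w: "w \<in> K" "w \<noteq> 0" "(*) w ` E \<subseteq> \<O>" "int (ideal_norm K ((*) w ` E)) dvd discriminant K"
    using order_two_class_representative[OF E sq nz] by metis
  have "A \<odot> (*) w ` E = (*) w ` C"
    unfolding ideal_prod_scale2 E_def
    using times_fid_inv_cancel(1)[OF A(1) C] ideal_prod_commute_complex by metis
  hence "ideal_class K (A \<odot> (*) w ` E) = ideal_class K C"
    using ideal_class_scale C w by simp
  thus ?thesis using that[of A "(*) w ` E"] A nA w E by (metis frac_scale)
qed

end

section \<open>Circles through points of the field\<close>

text \<open>The Hermitian form whose isotropic lines are the points of the circle; homogeneous, so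
  that a point of \<open>K\<close> can be evaluated at integral coordinates.\<close>

definition circle_form :: "circle_data \<Rightarrow> complex \<Rightarrow> complex \<Rightarrow> real" where
  "circle_form C a b = curvature C * (cmod a)\<^sup>2 - 2 * Re (cnj a * b * curv_center C)
     + cocurvature C * (cmod b)\<^sup>2"

text \<open>Over the complex numbers, with conjugates as separate atoms, identities between form
  values become polynomial identities that \<open>algebra_simps\<close> can settle.\<close>

lemma circle_form_complex:
  "complex_of_real (circle_form C a b) = of_real (curvature C) * (a * cnj a)
     - (cnj a * b * curv_center C + a * cnj b * cnj (curv_center C))
     + of_real (cocurvature C) * (b * cnj b)"
proof -
  have "complex_of_real (2 * Re (cnj a * b * curv_center C))
      = cnj a * b * curv_center C + cnj (cnj a * b * curv_center C)"
    by (simp only: complex_add_cnj)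
  thus ?thesis
    by (simp only: circle_form_def of_real_add of_real_diff of_real_mult[of _ "_\<^sup>2"] complex_norm_square
        complex_cnj_mult complex_cnj_cnj)
qed

lemma circle_form_mult: "circle_form C (a * c) (b * c) = (cmod c)\<^sup>2 * circle_form C a b"
proof -
  have "complex_of_real (circle_form C (a * c) (b * c)) = of_real ((cmod c)\<^sup>2 * circle_form C a b)"
    unfolding of_real_mult circle_form_complex complex_norm_square by (simp add: algebra_simps)
  thus ?thesis by (simp only: of_real_eq_iff)
qed

lemma Some_in_circle_points: "Some z \<in> circle_points C \<longleftrightarrow> circle_form C z 1 = 0"
proof
  assume "Some z \<in> circle_points C"
  then obtain a b where "Some z = ext_quotient a b" and 0: "circle_form C a b = 0"
    unfolding circle_points_def circle_form_def by blast
  hence b: "b \<noteq> 0" "a = z * b" by (auto simp: ext_quotient_def split: if_splits)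
  hence "circle_form C (z * b) (1 * b) = 0" using 0 by simp
  thus "circle_form C z 1 = 0" unfolding circle_form_mult using b by simp
next
  assume *: "circle_form C z 1 = 0"
  have "Some z = ext_quotient z 1" by (simp add: ext_quotient_def)
  moreover have "(z, 1) \<noteq> (0, 0 :: complex)" by simp
  ultimately show "Some z \<in> circle_points C"
    using * unfolding circle_points_def circle_form_def by blast
qed

lemma None_in_circle_points: "None \<in> circle_points C \<longleftrightarrow> curvature C = 0"
proof
  assume "None \<in> circle_points C"
  then obtain a b where "None = ext_quotient a b" and 0: "circle_form C a b = 0" "(a, b) \<noteq> (0, 0)"
    unfolding circle_points_def circle_form_def by blast
  hence b: "b = 0" by (auto simp: ext_quotient_def split: if_splits)
  thus "curvature C = 0" using 0 by (simp add: circle_form_def)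
next
  assume *: "curvature C = 0"
  hence "circle_form C 1 0 = 0" by (simp add: circle_form_def)
  moreover have "None = ext_quotient 1 0" by (simp add: ext_quotient_def)
  moreover have "(1 :: complex, 0 :: complex) \<noteq> (0, 0)" by simp
  ultimately show "None \<in> circle_points C"
    unfolding circle_points_def circle_form_def by blast
qed

lemma oriented_circle_complex:
  "oriented_circle C \<longleftrightarrow> curv_center C * cnj (curv_center C)
     - of_real (curvature C) * of_real (cocurvature C) = 1"
proof -
  have "oriented_circle C \<longleftrightarrow>
    complex_of_real ((cmod (curv_center C))\<^sup>2 - curvature C * cocurvature C) = of_real 1"
    unfolding oriented_circle_def of_real_eq_iff ..
  thus ?thesis
    unfolding of_real_diff of_real_mult complex_norm_square by simp
qed

text \<open>Completing the square; the constant term becomes -1 by the normalization of an oriented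
  circle.\<close>

lemma curvature_times_circle_form:
  assumes "oriented_circle C"
  shows "curvature C * circle_form C z 1 = (cmod (of_real (curvature C) * z - curv_center C))\<^sup>2 - 1"
proof -
  define \<zeta> where "\<zeta> = curv_center C"
  define r where "r = complex_of_real (curvature C)"
  define r' where "r' = complex_of_real (cocurvature C)"
  have o: "r * r' = \<zeta> * cnj \<zeta> - 1"
    using assms unfolding oriented_circle_complex \<zeta>_def r_def r'_def by (simp add: algebra_simps)
  have [simp]: "cnj r = r" by (simp add: r_def)
  have "complex_of_real (curvature C * circle_form C z 1)
      = r * r * z * cnj z - r * (cnj z * \<zeta> + z * cnj \<zeta>) + r * r'"
    unfolding of_real_mult circle_form_complex \<zeta>_def r_def r'_def by (simp add: algebra_simps)
  also have "\<dots> = (r * z - \<zeta>) * cnj (r * z - \<zeta>) - 1"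
    unfolding o by (simp add: algebra_simps)
  also have "\<dots> = complex_of_real ((cmod (r * z - \<zeta>))\<^sup>2 - 1)"
    unfolding of_real_diff complex_norm_square by simp
  finally show ?thesis unfolding \<zeta>_def r_def by (simp only: of_real_eq_iff)
qed

lemma on_circle_dist:
  assumes "oriented_circle C" "circle_form C z 1 = 0"
  shows "cmod (of_real (curvature C) * z - curv_center C) = 1"
  using curvature_times_circle_form[OF assms(1), of z] assms(2)
  by (simp add: power2_eq_1_iff) (smt (verit) norm_ge_zero)

lemma on_circle_diameter:
  assumes "oriented_circle C" "circle_form C z 1 = 0" "circle_form C w 1 = 0"
  shows "\<bar>curvature C\<bar> * cmod (z - w) \<le> 2"
proof -
  have "\<bar>curvature C\<bar> * cmod (z - w) =
      cmod ((of_real (curvature C) * z - curv_center C) - (of_real (curvature C) * w - curv_center C))"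
    by (simp add: norm_mult[symmetric] right_diff_distrib[symmetric] del: norm_mult)
      (simp add: norm_mult)
  also have "\<dots> \<le> 1 + 1"
    using norm_triangle_ineq4 on_circle_dist[OF assms(1)] assms by metis
  finally show ?thesis by simp
qed

text \<open>Expand around z: the constant term vanishes and the linear coefficient r z - \<zeta> has
  absolute value 1 because z is on the circle.\<close>

lemma circle_form_upper_bound:
  assumes "oriented_circle C" "circle_form C z 1 = 0"
  shows "\<bar>circle_form C p 1\<bar> \<le> \<bar>curvature C\<bar> * (cmod (p - z))\<^sup>2 + 2 * cmod (p - z)"
proof -
  define h where "h = p - z"
  define v where "v = of_real (curvature C) * z - curv_center C"
  have p: "p = z + h" by (simp add: h_def)
  have "complex_of_real (circle_form C p 1) = complex_of_real (circle_form C z 1)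
      + of_real (curvature C) * (h * cnj h) + (cnj h * v + cnj (cnj h * v))"
    unfolding circle_form_complex p v_def by (simp add: algebra_simps)
  also have "\<dots> = complex_of_real (curvature C * (cmod h)\<^sup>2 + 2 * Re (cnj h * v))"
    unfolding complex_add_cnj assms(2) of_real_add of_real_mult[of _ "_\<^sup>2"] complex_norm_square by simp
  finally have "circle_form C p 1 = curvature C * (cmod h)\<^sup>2 + 2 * Re (cnj h * v)"
    by (simp only: of_real_eq_iff)
  moreover have "\<bar>Re (cnj h * v)\<bar> \<le> cmod h"
    using abs_Re_le_cmod[of "cnj h * v"] on_circle_dist[OF assms]
    by (simp add: norm_mult v_def)
  moreover have "\<bar>curvature C * (cmod h)\<^sup>2\<bar> = \<bar>curvature C\<bar> * (cmod h)\<^sup>2" by (simp add: abs_mult)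
  ultimately show ?thesis unfolding h_def by linarith
qed

text \<open>Since |r p - \<zeta>|^2 = 1 + r * (value at p) and |r z - \<zeta>| = 1, the value at p
  limits how far p can be from any point of the circle.\<close>

lemma circle_form_lower_bound:
  assumes "oriented_circle C" "circle_form C z 1 = 0"
  shows "\<bar>curvature C\<bar> * cmod (p - z) \<le> 2 + sqrt (\<bar>curvature C\<bar> * \<bar>circle_form C p 1\<bar>)"
proof -
  let ?r = "complex_of_real (curvature C)"
  have "(cmod (?r * p - curv_center C))\<^sup>2 = 1 + curvature C * circle_form C p 1"
    using curvature_times_circle_form[OF assms(1), of p] by simp
  also have "\<dots> \<le> 1 + \<bar>curvature C\<bar> * \<bar>circle_form C p 1\<bar>"
    by (simp flip: abs_mult)
  also have "\<dots> \<le> (1 + sqrt (\<bar>curvature C\<bar> * \<bar>circle_form C p 1\<bar>))\<^sup>2"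
    by (simp add: power2_sum)
  finally have *: "cmod (?r * p - curv_center C) \<le> 1 + sqrt (\<bar>curvature C\<bar> * \<bar>circle_form C p 1\<bar>)"
    by (rule power2_le_imp_le) simp
  have "\<bar>curvature C\<bar> * cmod (p - z) = cmod ((?r * p - curv_center C) - (?r * z - curv_center C))"
    by (simp add: norm_mult[symmetric] right_diff_distrib[symmetric] del: norm_mult)
      (simp add: norm_mult)
  also have "\<dots> \<le> cmod (?r * p - curv_center C) + cmod (?r * z - curv_center C)"
    by (rule norm_triangle_ineq4)
  finally show ?thesis using * on_circle_dist[OF assms] by simp
qed

text \<open>Pull-back of the Hermitian form along the matrix with rows (p, q) and (u, v): curvature
  and cocurvature are the values at its columns, the center comes from the mixed entry.\<close>

definition circle_act :: "complex \<Rightarrow> complex \<Rightarrow> complex \<Rightarrow> complex \<Rightarrow> circle_data \<Rightarrow> circle_data" where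
  "circle_act p q u v C = \<lparr>
     curv_center = cnj p * v * curv_center C + q * cnj u * cnj (curv_center C)
       - of_real (curvature C) * cnj p * q - of_real (cocurvature C) * cnj u * v,
     cocurvature = circle_form C q v,
     curvature = circle_form C p u\<rparr>"

lemma circle_form_act:
  "circle_form (circle_act p q u v C) x y = circle_form C (p * x + q * y) (u * x + v * y)"
proof -
  have "complex_of_real (circle_form (circle_act p q u v C) x y)
      = of_real (circle_form C (p * x + q * y) (u * x + v * y))"
    unfolding circle_form_complex circle_act_def circle_data.simps
    by (simp add: algebra_simps)
  thus ?thesis by (simp only: of_real_eq_iff)
qed

text \<open>The determinant of a Hermitian form is multiplied by the squared absolute value of the
  determinant of the matrix.\<close>

lemma oriented_circle_act:
  assumes "oriented_circle C" "p * v - q * u = 1"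
  shows "oriented_circle (circle_act p q u v C)"
proof -
  define \<zeta> where "\<zeta> = curv_center C"
  have c: "cnj p * cnj v - cnj q * cnj u = 1" using arg_cong[OF assms(2), of cnj] by simp
  have "curv_center (circle_act p q u v C) * cnj (curv_center (circle_act p q u v C))
     - of_real (curvature (circle_act p q u v C)) * of_real (cocurvature (circle_act p q u v C))
     = (p * v - q * u) * (cnj p * cnj v - cnj q * cnj u) *
       (\<zeta> * cnj \<zeta> - of_real (curvature C) * of_real (cocurvature C))"
    unfolding circle_act_def circle_data.simps circle_form_complex \<zeta>_def
    by (simp add: algebra_simps)
  also have "\<dots> = 1" using assms c unfolding oriented_circle_complex \<zeta>_def by simp
  finally show ?thesis unfolding oriented_circle_complex .
qed

text \<open>In k the value is a quadratic polynomial with leading coefficient q, which the second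
  difference f(2k) - 2 f(k) + f(0) isolates. A natural parameter keeps the matrices over
  \<O>.\<close>

lemma circle_form_unbounded:
  assumes "circle_form C x y \<noteq> 0"
  obtains k :: nat where "\<bar>circle_form C (1 + of_nat k * x) (of_nat k * y)\<bar> > R"
proof -
  define f where "f k = circle_form C (1 + of_nat k * x) (of_nat k * y)" for k :: nat
  define q where "q = circle_form C x y"
  have second_diff: "f (2 * k) - 2 * f k + f 0 = 2 * (real k)\<^sup>2 * q" for k
  proof -
    have "complex_of_real (f (2 * k) - 2 * f k + f 0) = of_real (2 * (real k)\<^sup>2 * q)"
      unfolding f_def q_def of_real_add of_real_diff of_real_mult circle_form_complex
      by (simp add: algebra_simps power2_eq_square)
    thus ?thesis by (simp only: of_real_eq_iff)
  qed
  have "\<exists>k. \<bar>f k\<bar> > R"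
  proof (rule ccontr)
    assume "\<not> ?thesis"
    hence b: "\<bar>f k\<bar> \<le> R" for k by (simp add: not_less)
    obtain k :: nat where k: "real k > 2 * R / \<bar>q\<bar> + 1" using reals_Archimedean2 by blast
    have "2 * (real k)\<^sup>2 * \<bar>q\<bar> = \<bar>f (2 * k) - 2 * f k + f 0\<bar>" unfolding second_diff by (simp add: abs_mult)
    also have "\<dots> \<le> 4 * R" using b[of "2 * k"] b[of k] b[of 0] by linarith
    finally have 1: "(real k)\<^sup>2 * \<bar>q\<bar> \<le> 2 * R" by linarith
    have R: "R \<ge> 0" using b[of 0] by linarith
    hence "2 * R / \<bar>q\<bar> \<ge> 0" by simp
    hence "real k \<ge> 1" using k by linarith
    hence "real k * 1 \<le> real k * real k" by (intro mult_left_mono) auto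
    hence "real k * \<bar>q\<bar> \<le> (real k)\<^sup>2 * \<bar>q\<bar>" by (intro mult_right_mono) (auto simp: power2_eq_square)
    hence "real k * \<bar>q\<bar> \<le> 2 * R" using 1 by linarith
    hence "real k \<le> 2 * R / \<bar>q\<bar>" using assms by (simp add: q_def pos_le_divide_eq)
    thus False using k by linarith
  qed
  thus ?thesis using that unfolding f_def by blast
qed

section \<open>Arithmetic of the circle family and the effect of finite connectedness\<close>

context imaginary_quadratic
begin

lemma circle_family_iff:
  assumes "D > 0"
  shows "C \<in> circle_family K D \<longleftrightarrow> oriented_circle C \<and>
     \<i> * of_real (sqrt D) * curv_center C \<in> \<O> \<and> \<i> * of_real (sqrt D) * cnj (curv_center C) \<in> \<O> \<and>
     (\<exists>m :: int. \<i> * of_real (sqrt D) * of_real (cocurvature C) = (\<theta> - cnj \<theta>) * of_int m) \<and>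
     (\<exists>m :: int. \<i> * of_real (sqrt D) * of_real (curvature C) = (\<theta> - cnj \<theta>) * of_int m)"
  using assms by (simp add: circle_family_def Let_def sqrt_disc_theta csqrt_of_real_nonneg)

text \<open>The factor i sqrt(D) is purely imaginary, so the mixed terms combine to x - cnj x with x
  in \<O>, an integer multiple of \<theta> - cnj \<theta>.\<close>

lemma circle_form_family:
  assumes "D > 0" "C \<in> circle_family K D" "a \<in> \<O>" "b \<in> \<O>"
  obtains m :: int where
    "\<i> * of_real (sqrt D) * of_real (circle_form C a b) = (\<theta> - cnj \<theta>) * of_int m"
proof -
  define s where "s = \<i> * of_real (sqrt D)"
  define \<omega> where "\<omega> = s * curv_center C"
  obtain m m' :: int where \<omega>: "\<omega> \<in> \<O>"
    and m: "s * of_real (curvature C) = (\<theta> - cnj \<theta>) * of_int m"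
    and m': "s * of_real (cocurvature C) = (\<theta> - cnj \<theta>) * of_int m'"
    using assms(2) unfolding circle_family_iff[OF assms(1)] s_def[symmetric] \<omega>_def by blast
  have cs: "cnj s = - s" by (simp add: s_def)
  obtain na where na: "a * cnj a = of_int na" using O_trace_norm[OF assms(3)] by (auto elim!: Ints_cases)
  obtain nb where nb: "b * cnj b = of_int nb" using O_trace_norm[OF assms(4)] by (auto elim!: Ints_cases)
  have "cnj a * b * \<omega> \<in> \<O>" using assms \<omega> by blast
  then obtain k l where kl: "cnj a * b * \<omega> = of_int k + of_int l * \<theta>" by (rule O_cases)
  have "s * of_real (circle_form C a b)
      = (s * of_real (curvature C)) * (a * cnj a) - (cnj a * b * \<omega> - cnj (cnj a * b * \<omega>))
        + (s * of_real (cocurvature C)) * (b * cnj b)"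
    unfolding circle_form_complex \<omega>_def complex_cnj_mult cs by (simp add: algebra_simps)
  also have "\<dots> = (\<theta> - cnj \<theta>) * of_int (m * na - l + m' * nb)"
    unfolding m m' na nb kl by (simp add: algebra_simps)
  finally show ?thesis using that unfolding s_def by blast
qed

text \<open>The curvature and cocurvature terms enter the new center as multiples of \<theta> - cnj
  \<theta>, an element of \<O>; the new curvatures are form values at columns over \<O>.\<close>

lemma circle_act_family:
  assumes "D > 0" "C \<in> circle_family K D" "p \<in> \<O>" "q \<in> \<O>" "u \<in> \<O>" "v \<in> \<O>" "p * v - q * u = 1"
  shows "circle_act p q u v C \<in> circle_family K D"
proof -
  define s where "s = \<i> * of_real (sqrt D)"
  define \<omega> where "\<omega> = s * curv_center C"
  define \<omega>' where "\<omega>' = s * cnj (curv_center C)"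
  obtain m m' :: int where \<omega>: "\<omega> \<in> \<O>" "\<omega>' \<in> \<O>"
    and m: "s * of_real (curvature C) = (\<theta> - cnj \<theta>) * of_int m"
    and m': "s * of_real (cocurvature C) = (\<theta> - cnj \<theta>) * of_int m'"
    and C: "oriented_circle C"
    using assms(2) unfolding circle_family_iff[OF assms(1)] s_def[symmetric] \<omega>_def \<omega>'_def by blast
  have \<delta>: "\<theta> \<in> \<O>" "cnj \<theta> \<in> \<O>" using theta(1) by blast+
  note c = O_cnj[OF assms(3)] O_cnj[OF assms(4)] O_cnj[OF assms(5)] O_cnj[OF assms(6)]
  have "s * curv_center (circle_act p q u v C) = cnj p * v * \<omega> + q * cnj u * \<omega>'
       - (s * of_real (curvature C)) * cnj p * q - (s * of_real (cocurvature C)) * cnj u * v"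
    unfolding circle_act_def \<omega>_def \<omega>'_def by (simp add: algebra_simps)
  also have "\<dots> \<in> \<O>"
    unfolding m m' using assms(3-6) c \<omega> \<delta> by (intro O_add O_diff O_mult O_of_int)
  finally have 1: "s * curv_center (circle_act p q u v C) \<in> \<O>" .
  have "s * cnj (curv_center (circle_act p q u v C)) = p * cnj v * \<omega>' + cnj q * u * \<omega>
       - (s * of_real (curvature C)) * p * cnj q - (s * of_real (cocurvature C)) * u * cnj v"
    unfolding circle_act_def \<omega>_def \<omega>'_def by (simp add: algebra_simps)
  also have "\<dots> \<in> \<O>"
    unfolding m m' using assms(3-6) c \<omega> \<delta> by (intro O_add O_diff O_mult O_of_int)
  finally have 2: "s * cnj (curv_center (circle_act p q u v C)) \<in> \<O>" .
  have "\<exists>m :: int. s * of_real (circle_form C q v) = (\<theta> - cnj \<theta>) * of_int m"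
    "\<exists>m :: int. s * of_real (circle_form C p u) = (\<theta> - cnj \<theta>) * of_int m"
    using circle_form_family[OF assms(1,2)] assms(3-6) unfolding s_def by metis+
  thus ?thesis
    unfolding circle_family_iff[OF assms(1)] s_def[symmetric]
    using 1 2 oriented_circle_act[OF C assms(7)] by (simp add: circle_act_def)
qed

text \<open>All values at (a, b) are integer multiples of e = 2 \<open>Im \<theta>\<close> /
  sqrt(D), so the minimum is taken over natural numbers.\<close>

lemma circle_family_minimal_form:
  assumes "D > 0" "circle_family K D \<noteq> {}" "a \<in> \<O>" "b \<in> \<O>"
  obtains C where "C \<in> circle_family K D"
    "\<And>C'. C' \<in> circle_family K D \<Longrightarrow> \<bar>circle_form C a b\<bar> \<le> \<bar>circle_form C' a b\<bar>"
proof -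
  define e where "e = 2 * Im \<theta> / sqrt D"
  have e: "e > 0" using theta(2) assms(1) by (simp add: e_def)
  have int: "\<exists>n :: nat. \<bar>circle_form C a b\<bar> = e * of_nat n" if C: "C \<in> circle_family K D" for C
  proof -
    obtain m :: int where m:
      "\<i> * of_real (sqrt D) * of_real (circle_form C a b) = (\<theta> - cnj \<theta>) * of_int m"
      by (rule circle_form_family[OF assms(1) C assms(3,4)])
    have "sqrt D * circle_form C a b = 2 * Im \<theta> * of_int m" using arg_cong[OF m, of Im] by simp
    hence "circle_form C a b = e * of_int m" using assms(1) by (simp add: e_def field_simps)
    hence "\<bar>circle_form C a b\<bar> = e * of_nat (nat \<bar>m\<bar>)" using e by (simp add: abs_mult)
    thus ?thesis by blast
  qed
  obtain C0 where "C0 \<in> circle_family K D" using assms(2) by blast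
  then obtain C where C: "C \<in> circle_family K D" and
    min: "\<And>C'. C' \<in> circle_family K D \<Longrightarrow> nat \<lfloor>\<bar>circle_form C a b\<bar> / e\<rfloor> \<le> nat \<lfloor>\<bar>circle_form C' a b\<bar> / e\<rfloor>"
    using ex_has_least_nat[of "\<lambda>C. C \<in> circle_family K D" C0 "\<lambda>C. nat \<lfloor>\<bar>circle_form C a b\<bar> / e\<rfloor>"]
    by blast
  have "\<bar>circle_form C a b\<bar> \<le> \<bar>circle_form C' a b\<bar>" if C': "C' \<in> circle_family K D" for C'
  proof -
    obtain n n' :: nat where n: "\<bar>circle_form C a b\<bar> = e * of_nat n" "\<bar>circle_form C' a b\<bar> = e * of_nat n'"
      using int C C' by blast
    have "n \<le> n'" using min[OF C'] e unfolding n by simp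
    thus ?thesis unfolding n using e by simp
  qed
  thus ?thesis using that C by blast
qed

text \<open>At (1, 0) the form is the curvature itself. A minimal nonzero curvature would be halved
  by the end of its chain.\<close>

lemma infinity_on_circle:
  assumes "D > 0" "circle_family K D \<noteq> {}" "finitely_connected (circle_family K D)"
  shows "\<exists>C\<in>circle_family K D. None \<in> circle_points C"
proof -
  obtain C where C: "C \<in> circle_family K D" and
    min: "\<And>C'. C' \<in> circle_family K D \<Longrightarrow> \<bar>circle_form C 1 0\<bar> \<le> \<bar>circle_form C' 1 0\<bar>"
    using circle_family_minimal_form[OF assms(1,2) O_1 O_0] by metis
  have "curvature C = 0"
  proof (rule ccontr)
    assume nz: "curvature C \<noteq> 0"
    then obtain C' where "C' \<in> circle_family K D" "\<bar>curvature C'\<bar> \<le> \<bar>curvature C\<bar> / 2"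
      using assms(3) C unfolding finitely_connected_def by blast
    thus False using min[of C'] nz by (simp add: circle_form_def)
  qed
  thus ?thesis using C None_in_circle_points by blast
qed

text \<open>The first circle of the chain with at most half the initial curvature is still so close to
  \<open>p\<close> that its form at \<open>p\<close> is only about half as large.\<close>

lemma chain_halves_form:
  assumes fam: "\<And>C. C \<in> S \<Longrightarrow> oriented_circle C"
    and nz: "curvature (chain 0) \<noteq> 0"
    and chain: "\<forall>k\<le>n. chain k \<in> S"
    and meet: "\<forall>k\<in>{1..n}. circle_points (chain (k - 1)) \<inter> circle_points (chain k) \<noteq> {}"
    and last: "\<bar>curvature (chain n)\<bar> \<le> \<bar>curvature (chain 0)\<bar> / 2"
    and M: "M = 4 * real n + 2"
    and big: "\<bar>curvature (chain 0)\<bar> * \<bar>circle_form (chain 0) p 1\<bar> > (M\<^sup>2 + 6 * M + 4)\<^sup>2"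
  shows "\<exists>C\<in>S. \<bar>circle_form C p 1\<bar> < \<bar>circle_form (chain 0) p 1\<bar>"
proof -
  define r where "r = \<bar>curvature (chain 0)\<bar>"
  define \<mu> where "\<mu> = \<bar>circle_form (chain 0) p 1\<bar>"
  have r: "r > 0" using nz by (simp add: r_def)
  \<comment> \<open>All circles before index j have curvature above r / 2, hence diameter below 4 /
    r, which bounds each step of the walk. They also have nonzero curvature, so their meeting points
    are finite.\<close>
  define j where "j = (LEAST j. \<bar>curvature (chain j)\<bar> \<le> r / 2)"
  have j: "\<bar>curvature (chain j)\<bar> \<le> r / 2"
    unfolding j_def by (rule LeastI[of _ n]) (use last in \<open>simp add: r_def\<close>)
  have jn: "j \<le> n" unfolding j_def by (rule Least_le) (use last in \<open>simp add: r_def\<close>)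
  have before: "\<bar>curvature (chain k)\<bar> > r / 2" if "k < j" for k
    using not_less_Least[of k "\<lambda>j. \<bar>curvature (chain j)\<bar> \<le> r / 2"] that unfolding j_def by simp
  have "j \<noteq> 0"
  proof
    assume "j = 0"
    thus False using j r by (simp add: r_def)
  qed
  have ex_pt: "\<exists>z. circle_form (chain k) z 1 = 0 \<and> circle_form (chain (Suc k)) z 1 = 0" if "k < j" for k
  proof -
    have "Suc k \<in> {1..n}" using that jn by simp
    hence "circle_points (chain k) \<inter> circle_points (chain (Suc k)) \<noteq> {}"
      using meet by (metis diff_Suc_1)
    then obtain w where w: "w \<in> circle_points (chain k)" "w \<in> circle_points (chain (Suc k))" by blast
    have "curvature (chain k) \<noteq> 0" using before[OF that] r by auto
    hence "w \<noteq> None" using w(1) None_in_circle_points by metis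
    then obtain z where "w = Some z" by blast
    thus ?thesis using w unfolding \<open>w = Some z\<close> Some_in_circle_points by blast
  qed
  define x where "x k = (SOME z. circle_form (chain k) z 1 = 0 \<and> circle_form (chain (Suc k)) z 1 = 0)" for k
  have x: "circle_form (chain k) (x k) 1 = 0 \<and> circle_form (chain (Suc k)) (x k) 1 = 0" if "k < j" for k
    unfolding x_def using someI_ex[OF ex_pt[OF that]] .
  have step: "r * cmod (x k - x (Suc k)) \<le> 4" if "Suc k < j" for k
  proof -
    have "oriented_circle (chain (Suc k))" using fam chain that jn by simp
    hence "\<bar>curvature (chain (Suc k))\<bar> * cmod (x k - x (Suc k)) \<le> 2"
      using x[of k] x[of "Suc k"] that by (intro on_circle_diameter) auto
    moreover have "r / 2 * cmod (x k - x (Suc k)) \<le> \<bar>curvature (chain (Suc k))\<bar> * cmod (x k - x (Suc k))"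
      using before[OF that] by (intro mult_right_mono) auto
    ultimately show ?thesis by simp
  qed
  have walk: "r * cmod (p - x k) \<le> 2 + sqrt (r * \<mu>) + 4 * real k" if "k < j" for k
    using that
  proof (induction k)
    case 0
    thus ?case
      using circle_form_lower_bound[of "chain 0" "x 0" p] x[of 0] fam chain unfolding r_def \<mu>_def by simp
  next
    case (Suc k)
    have "cmod (p - x (Suc k)) \<le> cmod (p - x k) + cmod (x k - x (Suc k))"
      using norm_triangle_ineq[of "p - x k" "x k - x (Suc k)"] by simp
    hence "r * cmod (p - x (Suc k)) \<le> r * cmod (p - x k) + r * cmod (x k - x (Suc k))"
      using r by (simp flip: distrib_left)
    thus ?case using Suc step[of k] by simp
  qed
  \<comment> \<open>The last meeting point lies on the circle j of small curvature. There are j - 1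
    steps after the first point, whence the constant M = 4 n + 2: 4 per step and 2 from the distance
    bound on the initial circle.\<close>
  define z where "z = x (j - 1)"
  define h where "h = cmod (p - z)"
  define s where "s = sqrt (r * \<mu>)"
  have s2: "s\<^sup>2 = r * \<mu>" using r by (simp add: s_def \<mu>_def)
  have M2: "M \<ge> 2" using M by simp
  have "sqrt ((M\<^sup>2 + 6 * M + 4)\<^sup>2) < s"
    unfolding s_def using big by (intro real_sqrt_less_mono) (simp add: r_def \<mu>_def)
  hence s: "s > M\<^sup>2 + 6 * M + 4" using M2 by simp
  have "r * h \<le> 2 + s + 4 * real (j - 1)"
    unfolding h_def z_def s_def using \<open>j \<noteq> 0\<close> by (intro walk) simp
  moreover have "real (j - 1) \<le> real n" using jn by simp
  ultimately have rh: "r * h \<le> M + s" unfolding M by linarith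
  have C: "chain j \<in> S" using chain jn by simp
  have "circle_form (chain j) z 1 = 0" using x[of "j - 1"] \<open>j \<noteq> 0\<close> by (simp add: z_def)
  hence "\<bar>circle_form (chain j) p 1\<bar> \<le> \<bar>curvature (chain j)\<bar> * h\<^sup>2 + 2 * h"
    unfolding h_def by (intro circle_form_upper_bound fam C)
  also have "\<dots> \<le> r / 2 * h\<^sup>2 + 2 * h" using j by (intro add_right_mono mult_right_mono) auto
  finally have "2 * r * \<bar>circle_form (chain j) p 1\<bar> \<le> 2 * r * (r / 2 * h\<^sup>2 + 2 * h)"
    using r by simp
  also have "\<dots> = (r * h)\<^sup>2 + 4 * (r * h)" by (simp add: power2_eq_square algebra_simps)
  also have "\<dots> \<le> (M + s)\<^sup>2 + 4 * (M + s)"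
    using rh r by (intro add_mono power_mono) (auto simp: h_def)
  also have "\<dots> = s\<^sup>2 + (2 * M + 4) * s + (M\<^sup>2 + 4 * M)" by (simp add: power2_eq_square algebra_simps)
  \<comment> \<open>As s > 1, the excess (2 M + 4) s + M^2 + 4 M is at most (M^2 + 6 M + 4) s, and
    this is below s^2. This is the origin of the bound in the hypothesis \<open>big\<close>.\<close>
  also have "\<dots> < s\<^sup>2 + s\<^sup>2"
  proof -
    have "s > 1" using s M2 zero_le_power2[of M] by linarith
    hence "(M\<^sup>2 + 4 * M) * 1 \<le> (M\<^sup>2 + 4 * M) * s" using M2 by (intro mult_left_mono) auto
    moreover have "(M\<^sup>2 + 6 * M + 4) * s < s * s" using s \<open>s > 1\<close> by (intro mult_strict_right_mono) auto
    ultimately show ?thesis by (simp add: power2_eq_square algebra_simps)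
  qed
  also have "\<dots> = 2 * r * \<mu>" unfolding s2 by simp
  finally have "\<bar>circle_form (chain j) p 1\<bar> < \<mu>" using r by simp
  thus ?thesis using C unfolding \<mu>_def by blast
qed

lemma field_point_on_circle:
  assumes "D > 0" "circle_family K D \<noteq> {}" "finitely_connected (circle_family K D)" "p \<in> K"
  shows "\<exists>C\<in>circle_family K D. Some p \<in> circle_points C"
proof -
  obtain d :: int where d: "d > 0" "of_int d * p \<in> \<O>" by (rule K_denom[OF assms(4)])
  define a where "a = of_int d * p"
  define b where "b = complex_of_int d"
  have ab: "a \<in> \<O>" "b \<in> \<O>" "b \<noteq> 0" using d by (simp_all add: a_def b_def)
  have form: "circle_form C a b = (cmod b)\<^sup>2 * circle_form C p 1" for C
    using circle_form_mult[of C p b 1] by (simp add: a_def b_def mult.commute)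
  obtain C where C: "C \<in> circle_family K D" and
    min: "\<And>C'. C' \<in> circle_family K D \<Longrightarrow> \<bar>circle_form C a b\<bar> \<le> \<bar>circle_form C' a b\<bar>"
    using circle_family_minimal_form[OF assms(1,2) ab(1,2)] by metis
  have min': "\<bar>circle_form C p 1\<bar> \<le> \<bar>circle_form C' p 1\<bar>" if "C' \<in> circle_family K D" for C'
    using min[OF that] ab(3) by (simp add: form abs_mult)
  define \<mu> where "\<mu> = \<bar>circle_form C p 1\<bar>"
  have "\<mu> = 0"
  proof (rule ccontr)
    assume "\<mu> \<noteq> 0"
    hence \<mu>: "\<mu> > 0" by (simp add: \<mu>_def)
    obtain n where n: "\<forall>C\<in>circle_family K D. curvature C \<noteq> 0 \<longrightarrow>
       (\<exists>chain :: nat \<Rightarrow> circle_data.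
        chain 0 = C \<and> (\<forall>k\<le>n. chain k \<in> circle_family K D) \<and>
        (\<forall>k\<in>{1..n}. circle_points (chain (k - 1)) \<inter> circle_points (chain k) \<noteq> {}) \<and>
        \<bar>curvature (chain n)\<bar> \<le> \<bar>curvature C\<bar> / 2)"
      using assms(3)[unfolded finitely_connected_def] by (rule exE)
    define M where "M = 4 * real n + 2"
    \<comment> \<open>Curvature above \<open>B\<close> makes its product with \<mu> exceed the
      threshold; n, and hence \<open>B\<close>, is fixed before the circle is moved.\<close>
    define B where "B = (M\<^sup>2 + 6 * M + 4)\<^sup>2 / \<mu>"
    \<comment> \<open>The vector (a b, b b) is b times (a, b), so this leading coefficient is
      nonzero as long as \<mu> is.\<close>
    have "circle_form C (a * b) (b * b) \<noteq> 0"
      unfolding circle_form_mult form using ab(3) \<mu> by (auto simp: \<mu>_def)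
    then obtain k :: nat where k: "\<bar>circle_form C (1 + of_nat k * (a * b)) (of_nat k * (b * b))\<bar> > B"
      by (rule circle_form_unbounded)
    define t where "t = complex_of_nat k"
    have tO: "t \<in> \<O>" using O_of_int[of "int k"] by (simp add: t_def)
    \<comment> \<open>A unipotent matrix fixing the vector (a, b): it has determinant 1 and
      preserves the form value there, while its first column makes the curvature grow with
      t.\<close>
    define C1 where "C1 = circle_act (1 + t * (a * b)) (- (t * (a * a))) (t * (b * b)) (1 - t * (a * b)) C"
    have C1: "C1 \<in> circle_family K D"
      unfolding C1_def using ab tO
      by (intro circle_act_family assms(1) C O_add O_diff O_uminus O_mult O_1) (auto simp: algebra_simps)
    have "circle_form C1 a b = circle_form C a b"
      unfolding C1_def circle_form_act by (simp add: algebra_simps)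
    hence form1: "circle_form C1 p 1 = circle_form C p 1" using ab(3) by (simp add: form)
    have "B \<ge> 0" using \<mu> by (simp add: B_def)
    have curv: "\<bar>curvature C1\<bar> > B" using k by (simp add: C1_def circle_act_def t_def)
    hence "\<bar>curvature C1\<bar> * \<mu> > (M\<^sup>2 + 6 * M + 4)\<^sup>2" using \<mu> by (simp add: B_def field_simps)
    moreover have nz: "curvature C1 \<noteq> 0" using curv \<open>B \<ge> 0\<close> by auto
    moreover obtain chain where chain: "chain 0 = C1" "\<forall>k\<le>n. chain k \<in> circle_family K D"
        "\<forall>k\<in>{1..n}. circle_points (chain (k - 1)) \<inter> circle_points (chain k) \<noteq> {}"
        "\<bar>curvature (chain n)\<bar> \<le> \<bar>curvature C1\<bar> / 2"
      using n[rule_format, OF C1 nz] by (elim exE conjE)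
    ultimately have "\<exists>C'\<in>circle_family K D. \<bar>circle_form C' p 1\<bar> < \<bar>circle_form (chain 0) p 1\<bar>"
      by (intro chain_halves_form[of "circle_family K D" chain n M p])
        (simp_all add: M_def \<mu>_def form1 circle_family_def)
    then obtain C' where "C' \<in> circle_family K D" "\<bar>circle_form C' p 1\<bar> < \<bar>circle_form C1 p 1\<bar>"
      unfolding chain(1) by blast
    thus False using min'[of C'] form1 by simp
  qed
  thus ?thesis using C Some_in_circle_points by (auto simp: \<mu>_def)
qed

section \<open>Circles and ideal classes\<close>

text \<open>A circle through \<open>\<alpha> / \<beta>\<close>, where \<open>\<alpha>, \<beta>\<close> generate \<open>I\<close>, provides \<open>\<kappa>\<close> of norm \<open>D\<close> with
  \<open>\<kappa> * I\<close> contained in the conjugate of \<open>I\<close>: the associated sesquilinear form sends \<open>(\<alpha>, \<beta>)\<close> to a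
  linear form that vanishes at \<open>(\<alpha>, \<beta>)\<close>, hence is \<open>\<kappa> * (\<beta>, - \<alpha>)\<close>.\<close>

lemma circle_through_multiplier:
  assumes D: "D > 0" and C: "C \<in> circle_family K D" and I: "fid I"
    and gen: "I = {of_int x * \<alpha> + of_int y * \<beta> | x y. True}" and "\<beta> \<noteq> 0"
    and pt: "Some (\<alpha> / \<beta>) \<in> circle_points C"
  obtains \<kappa> where "\<kappa> \<in> K" "(cmod \<kappa>)\<^sup>2 = D" "(*) \<kappa> ` I \<subseteq> cnj ` I"
proof -
  define s where "s = \<i> * complex_of_real (sqrt D)"
  define \<zeta> where "\<zeta> = curv_center C"
  define r where "r = complex_of_real (curvature C)"
  define r' where "r' = complex_of_real (cocurvature C)"
  obtain m m' :: int where \<zeta>O: "s * \<zeta> \<in> \<O>" "s * cnj \<zeta> \<in> \<O>"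
    and m: "s * r = (\<theta> - cnj \<theta>) * of_int m"
    and m': "s * r' = (\<theta> - cnj \<theta>) * of_int m'"
    and oriented: "oriented_circle C"
    using C unfolding circle_family_iff[OF D] s_def[symmetric] \<zeta>_def r_def r'_def by blast
  have \<delta>: "\<theta> - cnj \<theta> \<in> \<O>" using O_diff[OF theta(1) O_cnj[OF theta(1)]] .
  have rO: "s * r \<in> \<O>" "s * r' \<in> \<O>" unfolding m m' using O_mult[OF \<delta>] by auto
  have \<alpha>I: "\<alpha> \<in> I" unfolding gen by (rule CollectI, rule exI[of _ 1], rule exI[of _ 0]) simp
  have \<beta>I: "\<beta> \<in> I" unfolding gen by (rule CollectI, rule exI[of _ 0], rule exI[of _ 1]) simp
  have J: "fid (cnj ` I)" using I by (rule frac_cnj)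
  have cI: "cnj \<alpha> \<in> cnj ` I" "cnj \<beta> \<in> cnj ` I" using \<alpha>I \<beta>I by blast+
  \<comment> \<open>The coefficients of the linear form: l \<alpha> + \<mu> \<beta> is s times the
    circle form at (\<alpha>, \<beta>), hence 0. Both l and \<mu> are combinations over \<O> of the
    conjugate generators.\<close>
  define l where "l = s * (r * cnj \<alpha> - cnj \<zeta> * cnj \<beta>)"
  define \<mu> where "\<mu> = s * (r' * cnj \<beta> - \<zeta> * cnj \<alpha>)"
  define \<kappa> where "\<kappa> = l / \<beta>"
  have zero: "circle_form C (\<alpha> / \<beta>) 1 = 0" using pt Some_in_circle_points by blast
  hence "circle_form C (\<alpha> / \<beta> * \<beta>) (1 * \<beta>) = 0" unfolding circle_form_mult by simp
  hence "complex_of_real (circle_form C \<alpha> \<beta>) = 0" using \<open>\<beta> \<noteq> 0\<close> by simp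
  hence "r * (\<alpha> * cnj \<alpha>) - (cnj \<alpha> * \<beta> * \<zeta> + \<alpha> * cnj \<beta> * cnj \<zeta>) + r' * (\<beta> * cnj \<beta>) = 0"
    unfolding circle_form_complex \<zeta>_def r_def r'_def .
  moreover have "l * \<alpha> + \<mu> * \<beta> =
      s * (r * (\<alpha> * cnj \<alpha>) - (cnj \<alpha> * \<beta> * \<zeta> + \<alpha> * cnj \<beta> * cnj \<zeta>) + r' * (\<beta> * cnj \<beta>))"
    by (simp add: l_def \<mu>_def algebra_simps)
  ultimately have "l * \<alpha> = - (\<mu> * \<beta>)" by (simp add: eq_neg_iff_add_eq_0)
  hence \<kappa>\<alpha>: "\<kappa> * \<alpha> = - \<mu>" using \<open>\<beta> \<noteq> 0\<close> by (simp add: \<kappa>_def field_simps)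
  have \<kappa>\<beta>: "\<kappa> * \<beta> = l" using \<open>\<beta> \<noteq> 0\<close> by (simp add: \<kappa>_def)
  have "l = (s * r) * cnj \<alpha> - (s * cnj \<zeta>) * cnj \<beta>" by (simp add: l_def algebra_simps)
  also have "\<dots> \<in> cnj ` I" by (intro frac_diff[OF J] fracD(5)[OF J] rO \<zeta>O cI)
  finally have lJ: "l \<in> cnj ` I" .
  have "- \<mu> = (s * \<zeta>) * cnj \<alpha> - (s * r') * cnj \<beta>" by (simp add: \<mu>_def algebra_simps)
  also have "\<dots> \<in> cnj ` I" by (intro frac_diff[OF J] fracD(5)[OF J] rO \<zeta>O cI)
  finally have \<mu>J: "- \<mu> \<in> cnj ` I" .
  have "(*) \<kappa> ` I \<subseteq> cnj ` I"
  proof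
    fix w assume "w \<in> (*) \<kappa> ` I"
    then obtain x y where "w = \<kappa> * (of_int x * \<alpha> + of_int y * \<beta>)" unfolding gen by blast
    hence "w = of_int x * (\<kappa> * \<alpha>) + of_int y * (\<kappa> * \<beta>)" by (simp add: algebra_simps)
    also have "\<dots> \<in> cnj ` I"
      unfolding \<kappa>\<alpha> \<kappa>\<beta> using lJ \<mu>J by (intro fracD(4)[OF J] frac_int_mult[OF J])
    finally show "w \<in> cnj ` I" .
  qed
  moreover have "\<kappa> \<in> K"
    unfolding \<kappa>_def using lJ \<beta>I fracD(1)[OF J] fracD(1)[OF I] by blast
  moreover have "(cmod \<kappa>)\<^sup>2 = D"
  proof -
    \<comment> \<open>With z = \<alpha> / \<beta> on the circle, |r z - \<zeta>| = 1, so |l| =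
      sqrt(D) |\<beta>|. This is where the norm D comes from.\<close>
    have "r * cnj \<alpha> - cnj \<zeta> * cnj \<beta> = cnj ((r * (\<alpha> / \<beta>) - \<zeta>) * \<beta>)"
      using \<open>\<beta> \<noteq> 0\<close> by (simp add: r_def algebra_simps)
    hence "cmod (r * cnj \<alpha> - cnj \<zeta> * cnj \<beta>) = cmod \<beta>"
      using on_circle_dist[OF oriented zero]
      by (simp only: complex_mod_cnj norm_mult r_def \<zeta>_def mult_1_left)
    moreover have "cmod s = sqrt D" using D by (simp add: s_def norm_mult)
    ultimately have "cmod \<kappa> = sqrt D" using \<open>\<beta> \<noteq> 0\<close> by (simp add: \<kappa>_def l_def norm_mult norm_divide)
    thus ?thesis using D by simp
  qed
  ultimately show ?thesis using that by blast
qed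

text \<open>From \<kappa> J contained in cnj J, the ideal \<kappa> J / cnj J is integral. It equals
  (\<kappa> / N(J)) (J * J), so it lies in the class of the square and has norm |\<kappa>|^2 = D. I
  is first scaled to an integral J to have a basis of two generators.\<close>

lemma square_represents:
  assumes D: "D > 0" and I: "fid I"
    and points: "\<And>p. p \<in> K \<Longrightarrow> \<exists>C\<in>circle_family K D. Some p \<in> circle_points C"
  obtains w where "w \<in> K" "w \<noteq> 0" "(*) w ` (I \<odot> I) \<subseteq> \<O>" "real (ideal_norm K ((*) w ` (I \<odot> I))) = D"
proof -
  obtain c where c: "c \<in> \<O>" "c \<noteq> 0" "(*) c ` I \<subseteq> \<O>" by (rule frac_denom[OF I])
  define J where "J = (*) c ` I"
  have J: "fid J" "J \<subseteq> \<O>" unfolding J_def using c I O_in_K by blast+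
  obtain a b d :: int where abd: "a > 0" "d > 0"
    "J = {of_int x * of_int a + of_int y * (of_int b + of_int d * \<theta>) | x y. True}"
    by (rule integral_ideal_basis[OF J])
  define \<beta> where "\<beta> = of_int b + of_int d * \<theta>"
  have basis: "J = {of_int x * of_int a + of_int y * \<beta> | x y. True}" unfolding \<beta>_def by (rule abd(3))
  have "\<beta> \<noteq> 0" using abd(2) theta_independent[of b d 0 0] by (simp add: \<beta>_def)
  have "\<beta> \<in> \<O>" unfolding \<beta>_def using theta(1) by blast
  hence "of_int a / \<beta> \<in> K" using O_in_K K_of_int by blast
  then obtain C where C: "C \<in> circle_family K D" "Some (of_int a / \<beta>) \<in> circle_points C"
    using points by blast
  obtain \<kappa> where \<kappa>: "\<kappa> \<in> K" "(cmod \<kappa>)\<^sup>2 = D" "(*) \<kappa> ` J \<subseteq> cnj ` J"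
    by (rule circle_through_multiplier[OF D C(1) J(1) basis \<open>\<beta> \<noteq> 0\<close> C(2)])
  have "\<kappa> \<noteq> 0" using \<kappa>(2) D by auto
  define g where "g = fid_norm J"
  have g: "of_real g \<in> K" "g > 0"
    using fid_norm_Rats[OF J(1)] fid_norm(1)[OF J(1)] by (auto simp: g_def)
  define v where "v = \<kappa> * inverse (of_real g)"
  have v: "v \<in> K" "v \<noteq> 0" using \<kappa> \<open>\<kappa> \<noteq> 0\<close> g by (auto simp: v_def)
  have JJ: "fid (J \<odot> J)" using J by blast
  have "fid_inv (cnj ` J) = (*) (inverse (of_real g)) ` J"
    unfolding fid_inv_def fid_norm_cnj[OF J(1)] g_def by (simp add: image_image)
  hence "fid_inv (cnj ` J) \<odot> (*) \<kappa> ` J = (*) v ` (J \<odot> J)"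
    by (simp only: ideal_prod_scale ideal_prod_scale2 scale_scale v_def)
  hence sub: "(*) v ` (J \<odot> J) \<subseteq> \<O>"
    using fid_inv_times_integral[OF frac_cnj[OF J(1)] \<kappa>(3)] by simp
  have "cmod v = cmod \<kappa> / g"
    using g(2) by (simp add: v_def norm_mult norm_inverse divide_inverse)
  hence "(cmod v)\<^sup>2 * (g * g) = (cmod \<kappa>)\<^sup>2"
    using g(2) by (simp add: power2_eq_square)
  hence norm: "real (ideal_norm K ((*) v ` (J \<odot> J))) = D"
    using fid_norm_integral[OF frac_scale[OF v JJ] sub] fid_norm_scale[OF JJ v(2)]
      fid_norm_times[OF J(1) J(1)] \<kappa>(2) by (simp add: g_def)
  have "J \<odot> J = (*) (c * c) ` (I \<odot> I)"
    by (simp only: J_def ideal_prod_scale ideal_prod_scale2 scale_scale)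
  hence eq: "(*) v ` (J \<odot> J) = (*) (v * (c * c)) ` (I \<odot> I)" by (simp only: scale_scale)
  have "v * (c * c) \<in> K" "v * (c * c) \<noteq> 0" using v c O_in_K[OF c(1)] by auto
  thus ?thesis using that sub norm unfolding eq by blast
qed

text \<open>The square of any class and the trivial class both contain an integral ideal of norm D,
  so D is a natural number and every class factors into A, of norm dividing D, and B, of norm
  dividing the discriminant.\<close>

lemma all_points_class_group:
  assumes D: "D > 0"
    and points: "\<And>p. p \<in> K \<Longrightarrow> \<exists>C\<in>circle_family K D. Some p \<in> circle_points C"
  shows "generate (class_group K)
      {ideal_class K P | P. primeideal P (integer_ring K) \<and> P \<noteq> {0} \<and>
         (\<exists>k :: int. D * real_of_int (discriminant K) = real_of_int k * real (ideal_norm K P))}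
      = carrier (class_group K)" (is "generate _ ?S = _")
proof
  interpret group "class_group K" by (rule group_class_group)
  have "ideal_class K P \<in> carrier (class_group K)"
    if "primeideal P (integer_ring K)" "P \<noteq> {0}" for P
    using fid_of_ideal(1)[of P] primeideal.axioms(1)[OF that(1)] that(2)
    unfolding carrier_class_group by blast
  hence "?S \<subseteq> carrier (class_group K)" by blast
  thus "generate (class_group K) ?S \<subseteq> carrier (class_group K)" by (rule generate_incl)
  show "carrier (class_group K) \<subseteq> generate (class_group K) ?S"
  proof
    fix c assume "c \<in> carrier (class_group K)"
    then obtain C where C: "fid C" "c = ideal_class K C" unfolding carrier_class_group by blast
    obtain x where x: "x \<in> K" "x \<noteq> 0" "(*) x ` (C \<odot> C) \<subseteq> \<O>" "real (ideal_norm K ((*) x ` (C \<odot> C))) = D"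
      by (rule square_represents[OF D C(1) points])
    obtain y where y: "y \<in> K" "y \<noteq> 0" "(*) y ` (\<O> \<odot> \<O>) \<subseteq> \<O>" "real (ideal_norm K ((*) y ` (\<O> \<odot> \<O>))) = D"
      by (rule square_represents[OF D frac_O points])
    note OO = O_times[OF frac_O]
    define n where "n = ideal_norm K ((*) x ` (C \<odot> C))"
    have n: "D = real n" using x by (simp add: n_def)
    have "ideal_norm K ((*) y ` \<O>) = n" using y(4) unfolding OO n by simp
    then obtain A B where A: "fid A" "A \<subseteq> \<O>" "ideal_norm K A dvd n"
      and B: "fid B" "B \<subseteq> \<O>" "int (ideal_norm K B) dvd discriminant K"
      and AB: "ideal_class K C = ideal_class K (A \<odot> B)"
      using class_factorization[OF C(1) x(1,2) y(1,2) x(3) y(3)[unfolded OO] n_def[symmetric]] by metis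
    \<comment> \<open>A single natural number divisible by the norms of A and B; the real equation
      defining the generating set is divisibility of D times the discriminant, where the sign is
      harmless.\<close>
    define N where "N = n * nat \<bar>discriminant K\<bar>"
    have "ideal_norm K P dvd N \<Longrightarrow>
      \<exists>k :: int. D * real_of_int (discriminant K) = real_of_int k * real (ideal_norm K P)" for P
    proof -
      assume "ideal_norm K P dvd N"
      hence "int (ideal_norm K P) dvd int n * \<bar>discriminant K\<bar>"
        unfolding N_def by (simp flip: int_dvd_int_iff)
      hence "int (ideal_norm K P) dvd int n * discriminant K"
        by (metis abs_mult abs_of_nat dvd_abs_iff)
      then obtain k where "int n * discriminant K = int (ideal_norm K P) * k" ..
      from arg_cong[OF this, of real_of_int]
      have "D * real_of_int (discriminant K) = real_of_int k * real (ideal_norm K P)"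
        by (simp add: n mult.commute)
      thus ?thesis ..
    qed
    hence gen: "ideal_class K P \<in> ?S"
      if "primeideal P (integer_ring K)" "P \<noteq> {0}" "ideal_norm K P dvd N" for P
      using that by blast
    have "ideal_norm K B dvd nat \<bar>discriminant K\<bar>"
      using B(3) by (simp add: nat_abs_dvd_iff dvd_nat_abs_iff)
    hence "ideal_norm K A dvd N" "ideal_norm K B dvd N"
      unfolding N_def using A(3) by auto
    hence "ideal_class K A \<in> generate (class_group K) ?S" "ideal_class K B \<in> generate (class_group K) ?S"
      using ideal_class_in_generate[OF A(1,2) _ gen] ideal_class_in_generate[OF B(1,2) _ gen] by blast+
    hence "ideal_class K A \<otimes>\<^bsub>class_group K\<^esub> ideal_class K B \<in> generate (class_group K) ?S"
      by (rule generate.eng)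
    thus "c \<in> generate (class_group K) ?S"
      using ideal_class_times[OF A(1) B(1)] AB C by simp
  qed
qed

lemma all_points_principal_genus:
  assumes D: "D > 0"
    and points: "\<And>p. p \<in> K \<Longrightarrow> \<exists>C\<in>circle_family K D. Some p \<in> circle_points C"
    and c: "c \<in> principal_genus K"
  shows "\<exists>I\<in>c. ideal I (integer_ring K) \<and> real (ideal_norm K I) = D"
proof -
  obtain J where J: "fid J" "c = ideal_class K J \<otimes>\<^bsub>class_group K\<^esub> ideal_class K J"
    using c unfolding principal_genus_def carrier_class_group by blast
  have JJ: "fid (J \<odot> J)" using J(1) by blast
  have c_eq: "c = {(*) x ` (J \<odot> J) | x. x \<in> K \<and> x \<noteq> 0}"
    using J ideal_class_times ideal_class_eq[OF JJ] by simp
  obtain w where w: "w \<in> K" "w \<noteq> 0" "(*) w ` (J \<odot> J) \<subseteq> \<O>" "real (ideal_norm K ((*) w ` (J \<odot> J))) = D"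
    by (rule square_represents[OF D J(1) points])
  have "(*) w ` (J \<odot> J) \<in> c" unfolding c_eq using w by blast
  thus ?thesis using ideal_of_fid[OF frac_scale[OF w(1,2) JJ] w(3)] w(4) by blast
qed

end

theorem theorem5p12:
  fixes K :: "complex set" and D :: real
  assumes "imaginary_quadratic_field K"
    and "D > 0"
    and "circle_family K D \<noteq> {}"
    and "finitely_connected (circle_family K D)"
  shows "(\<forall>p\<in>extended_field K. \<exists>C\<in>circle_family K D. p \<in> circle_points C) \<and>
    generate (class_group K)
      {ideal_class K P | P. primeideal P (integer_ring K) \<and> P \<noteq> {0} \<and>
         (\<exists>k :: int. D * real_of_int (discriminant K) = real_of_int k * real (ideal_norm K P))}
      = carrier (class_group K) \<and>
    (\<forall>c\<in>principal_genus K. \<exists>I\<in>c. ideal I (integer_ring K) \<and> real (ideal_norm K I) = D)"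
proof -
  interpret imaginary_quadratic K by unfold_locales fact
  have points: "\<exists>C\<in>circle_family K D. Some p \<in> circle_points C" if "p \<in> K" for p
    using field_point_on_circle assms(2-4) that by blast
  have "\<exists>C\<in>circle_family K D. p \<in> circle_points C" if "p \<in> extended_field K" for p
    using that points infinity_on_circle[OF assms(2-4)] unfolding extended_field_def by blast
  thus ?thesis
    using all_points_class_group[OF assms(2) points] all_points_principal_genus[OF assms(2) points]
    by blast
qed

end
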